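(* Consider the distributionally robust problem described in the context, with risk function $f$. Case 1: Suppose there exists $T_1$ such that either (a) $f$ is increasing, concave and $C^2$ on $(-\infty,T_1)$ and $f''(t)/f'(t)\to0$ as $t\to-\infty$; or (b) $f$ is $C^1$ on $(-\infty,T_1)$ and $\lim_{t\to-\infty}f'(t)$ exists, is positive and is finite. Then there exists $T^r_f$ such that, for any $T\ge0$, every optimal strategy for the robust problem, at every history at which the current node is $i\neq d$ and the total cost spent so far is larger than $T-T^r_f$, moves to a node of $\mathcal{T}^r(i)$ (i.e. follows the shortest-path tree rooted at $d$ with respect to the worst-case mean arc costs). Case 2: If there exists $T_f$ such that the support of $f$ is included in $[T_f,\infty)$, then following $\mathcal{T}^r$ is optimal as soon as the total cost spent so far is larger than $T-T_f$.
   Context: Let $\mathcal{G}=(\mathcal{V},\mathcal{A})$ be a finite directed graph with source $s$ and destination $d$, $\mathcal{V}(i)=\{j:(i,j)\in\mathcal{A}\}$, $0<\delta^{\inf}_{ij}\le\delta^{\sup}_{ij}<\infty$ for each arc. For each arc $(i,j)$, an ambiguity set $\mathcal{P}_{ij}$ is given: a nonempty set of probability measures on $[\delta^{\inf}_{ij},\delta^{\sup}_{ij}]$, closed for the weak topology. A user starts at $s$ with budget $T$ and travels along arcs until reaching $d$, observing each arc cost after crossing. $\Pi$ is the set of history-dependent randomized strategies (maps from histories of visited nodes and realized costs, ending at $i\neq d$, to distributions over $\mathcal{V}(i)$); $X_\pi$ is the total cost of $\pi$ from $s$ to $d$. For each arc $(i,j)$ and each value $\tau\ge0$ of the total cost already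 spent, the cost $c^\tau_{ij}$ of crossing $(i,j)$ at that moment is distributed according to $p^\tau_{ij}$, all costs being independent. The robust problem is $$\sup_{\pi\in\Pi}\ \inf_{\forall\tau,\forall(i,j)\in\mathcal{A},\ p^\tau_{ij}\in\mathcal{P}_{ij}}\ \mathbb{E}_{\mathbf{p}^\tau}[f(T-X_\pi)].$$ Let $m_{ij}=\max_{p\in\mathcal{P}_{ij}}\mathbb{E}_{X\sim p}[X]$ (worst-case mean costs), $M_i$ the shortest-path distance from $i$ to $d$ with arc lengths $m_{ij}$ (implicitly assumed finite), and $\mathcal{T}^r(i)=\{j\in\mathcal{V}(i): m_{ij}+M_j=M_i\}$ the set of immediate successors of $i$ in the shortest-path tree $\mathcal{T}^r$ rooted at $d$ with respect to these worst-case mean costs.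
   Formalization: "Optimal" is read as optimal from the given history onward (Bellman sense): a strategy optimal only from the source may act arbitrarily at histories it or the worst case never reaches, so the literal claim "at every history" is false. Strategies and cost families are taken measurable. *)

theory Defs
  imports "HOL-Probability.Probability" "Graph_Theory.Pair_Digraph" "Graph_Theory.Shortest_Path"
begin

section \<open>Networks with ambiguous arc costs\<close>

record 'v network =
  graph :: "'v pair_pre_digraph"
  source :: 'v
  dest :: 'v
  lower :: "'v \<times> 'v \<Rightarrow> real"
  upper :: "'v \<times> 'v \<Rightarrow> real"
  ambiguity :: "'v \<times> 'v \<Rightarrow> real measure set"

abbreviation successors :: "'v network \<Rightarrow> 'v \<Rightarrow> 'v set" where
  "successors N i \<equiv> {j. (i, j) \<in> parcs (graph N)}"

text \<open>Probability measures on \<open>[a, b]\<close>, represented as Borel measures on the whole line.\<close>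

definition prob_measures_on :: "real \<Rightarrow> real \<Rightarrow> real measure set" where
  "prob_measures_on a b = {p. real_distribution p \<and> measure p {a..b} = 1}"

text \<open>The weak topology on the probability measures on \<open>[a, b]\<close>: the coarsest topology for which
  all functionals given by integration of a bounded continuous function are continuous.\<close>

definition weak_topology_on :: "real \<Rightarrow> real \<Rightarrow> real measure topology" where
  "weak_topology_on a b = topology_generated_by
     {{p \<in> prob_measures_on a b. (\<integral>x. g x \<partial>p) \<in> U} | (g :: real \<Rightarrow> real) U.
        continuous_on UNIV g \<and> bounded (range g) \<and> open U}"

text \<open>The supremum is attained, since a weakly closed set of probability measures on a compact
  interval is weakly compact.\<close>

definition worst_mean :: "'v network \<Rightarrow> 'v \<times> 'v \<Rightarrow> real" where
  "worst_mean N a = (SUP p\<in>ambiguity N a. \<integral>x. x \<partial>p)"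

definition worst_dist :: "'v network \<Rightarrow> 'v \<Rightarrow> ereal" where
  "worst_dist N i = wf_digraph.\<mu> (with_proj (graph N)) (worst_mean N) i (dest N)"

definition tree_successors :: "'v network \<Rightarrow> 'v \<Rightarrow> 'v set" where
  "tree_successors N i =
     {j \<in> successors N i. ereal (worst_mean N (i, j)) + worst_dist N j = worst_dist N i}"

locale robust_routing =
  G: pair_fin_digraph "graph N" for N :: "'v network" +
  assumes source_in: "source N \<in> pverts (graph N)"
    and dest_in: "dest N \<in> pverts (graph N)"
    and cost_bounds: "a \<in> parcs (graph N) \<Longrightarrow> 0 < lower N a \<and> lower N a \<le> upper N a"
    and ambiguity_nonempty: "a \<in> parcs (graph N) \<Longrightarrow> ambiguity N a \<noteq> {}"
    and ambiguity_subset: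
      "a \<in> parcs (graph N) \<Longrightarrow> ambiguity N a \<subseteq> prob_measures_on (lower N a) (upper N a)"
    and ambiguity_closed:
      "a \<in> parcs (graph N) \<Longrightarrow> closedin (weak_topology_on (lower N a) (upper N a)) (ambiguity N a)"
    and worst_dist_finite: "i \<in> pverts (graph N) \<Longrightarrow> worst_dist N i < \<infinity>"


section \<open>Histories and strategies\<close>

text \<open>A history is the chronological list of the moves made so far, each move being recorded as
  the node reached together with the realized cost of the arc crossed.\<close>

type_synonym 'v history = "('v \<times> real) list"

definition current :: "'v network \<Rightarrow> 'v history \<Rightarrow> 'v" where
  "current N h = (if h = [] then source N else fst (last h))"

definition spent :: "'v history \<Rightarrow> real" where
  "spent h = sum_list (map snd h)"

inductive_set histories :: "'v network \<Rightarrow> 'v history set" for N :: "'v network" where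
  start: "[] \<in> histories N"
| move: "h \<in> histories N \<Longrightarrow> current N h \<noteq> dest N \<Longrightarrow> (current N h, j) \<in> parcs (graph N) \<Longrightarrow>
    c \<in> {lower N (current N h, j)..upper N (current N h, j)} \<Longrightarrow> h @ [(j, c)] \<in> histories N"

abbreviation move_space :: "('v \<times> real) measure" where
  "move_space \<equiv> count_space UNIV \<Otimes>\<^sub>M borel"

text \<open>Strategies have to depend measurably on the realized costs, for otherwise the distribution of
  the total cost does not exist. Their values outside of \<open>histories N\<close> and at histories ending
  at the destination are irrelevant.\<close>

definition strategies :: "'v network \<Rightarrow> ('v history \<Rightarrow> 'v pmf) set" where
  "strategies N = {\<pi>.
     (\<forall>h\<in>histories N. current N h \<noteq> dest N \<longrightarrow> set_pmf (\<pi> h) \<subseteq> successors N (current N h)) \<and>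
     (\<forall>n j. (\<lambda>\<omega>. pmf (\<pi> (map \<omega> [0..<n])) j) \<in> borel_measurable
        (restrict_space (PiM {0..<n} (\<lambda>_. move_space))
          {\<omega>. map \<omega> [0..<n] \<in> histories N \<and> current N (map \<omega> [0..<n]) \<noteq> dest N}))}"

text \<open>A family \<open>p\<close> gives the distribution \<open>p \<tau> a\<close> of the cost of arc \<open>a\<close> when it is entered after a
  total cost of \<open>\<tau>\<close> has been spent. The dependence on \<open>\<tau>\<close> has to be measurable.\<close>

definition cost_families :: "'v network \<Rightarrow> (real \<Rightarrow> 'v \<times> 'v \<Rightarrow> real measure) set" where
  "cost_families N = {p. \<forall>a\<in>parcs (graph N).
     (\<forall>\<tau>\<ge>0. p \<tau> a \<in> ambiguity N a) \<and>
     (\<lambda>\<tau>. p \<tau> a) \<in> restrict_space borel {0..} \<rightarrow>\<^sub>M prob_algebra borel}"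


section \<open>The law of a trajectory and the robust problem\<close>

text \<open>Since all arc costs are positive, the total cost spent strictly increases along a trajectory,
  so that no cost variable is drawn twice. Independence of the costs thus amounts to this: given
  the history \<open>h\<close> and the next node \<open>j\<close>, the cost has distribution
  \<open>p (spent h) (current N h, j)\<close>. Once the destination has been reached, the trajectory is continued
  by dummy moves of cost \<open>0\<close>. The other use of the dummy move, outside of the valid histories and
  arcs, concerns events of probability zero only; it makes \<open>next_move\<close> a probability kernel.\<close>

definition next_move ::
  "'v network \<Rightarrow> (real \<Rightarrow> 'v \<times> 'v \<Rightarrow> real measure) \<Rightarrow> ('v history \<Rightarrow> 'v pmf) \<Rightarrow>
     'v history \<Rightarrow> ('v \<times> real) measure" where
  "next_move N p \<pi> h =
     (let dummy = return move_space (dest N, 0); i = current N h in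
      if h \<in> histories N \<and> i \<noteq> dest N
      then measure_pmf (\<pi> h) \<bind> (\<lambda>j.
        if (i, j) \<in> parcs (graph N) then distr (p (spent h) (i, j)) move_space (Pair j) else dummy)
      else dummy)"

text \<open>The law of the sequence of moves made after the history \<open>h\<close>, constructed with the theorem of
  Ionescu-Tulcea.\<close>

definition trajectory ::
  "'v network \<Rightarrow> (real \<Rightarrow> 'v \<times> 'v \<Rightarrow> real measure) \<Rightarrow> ('v history \<Rightarrow> 'v pmf) \<Rightarrow>
     'v history \<Rightarrow> (nat \<Rightarrow> 'v \<times> real) measure" where
  "trajectory N p \<pi> h = projective_family.lim UNIV
     (Ionescu_Tulcea.CI (\<lambda>n \<omega>. next_move N p \<pi> (h @ map \<omega> [0..<n])) (\<lambda>_. move_space))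
     (\<lambda>_. move_space)"

text \<open>The total cost from the source to the destination of a trajectory which starts with \<open>h\<close> and
  continues with the moves \<open>\<omega>\<close>. It is infinite if the destination is never reached, since the arc
  costs are bounded away from \<open>0\<close>.\<close>

definition total_cost :: "'v history \<Rightarrow> (nat \<Rightarrow> 'v \<times> real) \<Rightarrow> ennreal" where
  "total_cost h \<omega> = ennreal (spent h) + (\<Sum>n. ennreal (snd (\<omega> n)))"

text \<open>A trajectory which never reaches the destination is valued at the limit of \<open>f\<close> at
  \<open>-\<infinity>\<close>.\<close>

definition payoff :: "(real \<Rightarrow> real) \<Rightarrow> real \<Rightarrow> ennreal \<Rightarrow> ereal" where
  "payoff f T x =
     (if x = \<infinity> then Lim at_bot (\<lambda>t. ereal (f t)) else ereal (f (T - enn2real x)))"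

text \<open>Expectation of an extended real random variable; only meaningful if at least one of the two
  parts is finite.\<close>

definition ereal_expectation :: "'a measure \<Rightarrow> ('a \<Rightarrow> ereal) \<Rightarrow> ereal" where
  "ereal_expectation M g =
     enn2ereal (\<integral>\<^sup>+\<omega>. e2ennreal (g \<omega>) \<partial>M) - enn2ereal (\<integral>\<^sup>+\<omega>. e2ennreal (- g \<omega>) \<partial>M)"

definition expected_payoff ::
  "'v network \<Rightarrow> (real \<Rightarrow> real) \<Rightarrow> real \<Rightarrow> (real \<Rightarrow> 'v \<times> 'v \<Rightarrow> real measure) \<Rightarrow>
     ('v history \<Rightarrow> 'v pmf) \<Rightarrow> 'v history \<Rightarrow> ereal" where
  "expected_payoff N f T p \<pi> h =
     ereal_expectation (trajectory N p \<pi> h) (\<lambda>\<omega>. payoff f T (total_cost h \<omega>))"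

definition worst_case_payoff ::
  "'v network \<Rightarrow> (real \<Rightarrow> real) \<Rightarrow> real \<Rightarrow> ('v history \<Rightarrow> 'v pmf) \<Rightarrow> 'v history \<Rightarrow> ereal" where
  "worst_case_payoff N f T \<pi> h = (INF p\<in>cost_families N. expected_payoff N f T p \<pi> h)"

text \<open>Optimality of \<open>\<pi>\<close> for the robust problem with budget \<open>T\<close> from the history \<open>h\<close> on. For the
  empty history this is optimality for the robust problem itself; a strategy that is optimal in the
  sense of dynamic programming is optimal from every history on. Optimality from the empty history
  alone would not constrain the decisions at histories which a worst-case cost family avoids.\<close>

definition optimal_from ::
  "'v network \<Rightarrow> (real \<Rightarrow> real) \<Rightarrow> real \<Rightarrow> ('v history \<Rightarrow> 'v pmf) \<Rightarrow> 'v history \<Rightarrow> bool" where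
  "optimal_from N f T \<pi> h \<longleftrightarrow> \<pi> \<in> strategies N \<and>
     worst_case_payoff N f T \<pi> h = (SUP \<pi>'\<in>strategies N. worst_case_payoff N f T \<pi>' h)"

definition follows_tree_from :: "'v network \<Rightarrow> ('v history \<Rightarrow> 'v pmf) \<Rightarrow> 'v history \<Rightarrow> bool" where
  "follows_tree_from N \<pi> h \<longleftrightarrow>
     (\<forall>h'. h @ h' \<in> histories N \<and> current N (h @ h') \<noteq> dest N \<longrightarrow>
        set_pmf (\<pi> (h @ h')) \<subseteq> tree_successors N (current N (h @ h')))"

end

theory Submission
  imports Defs
begin

text \<open>In terms of the excess \<open>s = spent - T\<close>, a strategy is charged the loss \<open>l s = - f (- s)\<close>. Both
  assumptions of Case 1 say that the slope \<open>F\<close> of \<open>l\<close> varies slowly, so that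
  \<open>l (s + y) = l s + y * F s + o (F s)\<close> uniformly for bounded \<open>y\<close>. Backward induction along the
  shortest-path tree, where nature maximizes the mean loss over each arc and the user minimizes over
  the tree successors, defines losses \<open>U i\<close> with \<open>U i s = l s + M i * F s + o (F s)\<close>. Hence leaving
  the tree at \<open>i\<close> costs strictly more than \<open>U i s\<close> for large \<open>s\<close>. The minimizing strategy loses at
  most \<open>U i s\<close> against every cost family (a supermartingale), and against a nearly worst cost family
  every strategy \<open>\<pi>\<close> loses almost the \<open>\<pi>\<close>-average of the values of the arcs which it may take
  (a submartingale). So an optimal strategy gives weight only to tree successors, however small the
  weight of another arc might be. In Case 2 all payoffs vanish.\<close>

text \<open>Only tree arcs enter the recursion, because on all arcs of a graph with cycles backward
  induction would have no base. That nothing is lost this way is a verification argument above a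
  threshold: there every arc off the tree is strictly worse, and since the excess never decreases
  along a trajectory, no later history falls below the threshold. Everything depends on
  \<open>spent h - T\<close>, so one threshold serves all budgets. Three obstacles shape the rest. A
  trajectory that never arrives has infinite loss, so passing to the limit along the stages has to
  be justified: Fatou for the upper bound, domination by \<open>K * l\<close> for the lower one. A
  worst distribution would have to be selected measurably in the cost already spent; a nearly worst
  one is taken instead, with errors that add up to at most \<open>\<kappa> * exp (- s)\<close> along
  a trajectory starting at excess \<open>s\<close>. And since an off-tree weight has no lower bound,
  the first move is kept exactly in the lower bound, and \<open>\<kappa>\<close> tends to 0 with the
  history and the strategy fixed.\<close>

section \<open>Slowly varying slopes\<close>

text \<open>In the applications \<open>F\<close> is the slope of the loss \<open>l\<close> and \<open>M\<close> the worst-case mean cost still to come.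
  The uniformity in \<open>y\<close> lets the expansion survive the integration over an arc cost.\<close>

definition first_order :: "(real \<Rightarrow> real) \<Rightarrow> (real \<Rightarrow> real) \<Rightarrow> (real \<Rightarrow> real) \<Rightarrow> real \<Rightarrow> bool" where
  "first_order l F U M \<longleftrightarrow> (\<forall>C>0. \<forall>e>0. \<forall>\<^sub>F s in at_top. \<forall>y\<in>{0..C}.
     \<bar>U (s + y) - l s - (M + y) * F s\<bar> \<le> e * F s)"

lemma first_orderD:
  assumes "first_order l F U M" "C > 0" "e > 0"
  shows "\<forall>\<^sub>F s in at_top. \<forall>y\<in>{0..C}. \<bar>U (s + y) - l s - (M + y) * F s\<bar> \<le> e * F s"
  using assms unfolding first_order_def by blast

lemma first_order_self:
  fixes l F :: "real \<Rightarrow> real"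
  assumes deriv: "\<And>s. s > a \<Longrightarrow> (l has_real_derivative F s) (at s)"
    and slow: "\<And>C e. C > 0 \<Longrightarrow> e > 0 \<Longrightarrow> \<forall>\<^sub>F s in at_top. \<forall>y\<in>{0..C}. \<bar>F (s + y) - F s\<bar> \<le> e * F s"
  shows "first_order l F l 0"
  unfolding first_order_def
proof (intro allI impI)
  fix C e :: real assume Ce: "C > 0" "e > 0"
  \<comment> \<open>The mean value theorem will multiply the error of the slope by \<open>y\<close>,
    which is at most \<open>C\<close>.\<close>
  have "\<forall>\<^sub>F s in at_top. \<forall>y\<in>{0..C}. \<bar>F (s + y) - F s\<bar> \<le> e / C * F s"
    using Ce by (intro slow) auto
  then show "\<forall>\<^sub>F s in at_top. \<forall>y\<in>{0..C}. \<bar>l (s + y) - l s - (0 + y) * F s\<bar> \<le> e * F s"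
    using eventually_gt_at_top[of a]
  proof eventually_elim
    case (elim s)
    show ?case
    proof
      fix y assume y: "y \<in> {0..C}"
      show "\<bar>l (s + y) - l s - (0 + y) * F s\<bar> \<le> e * F s"
      proof (cases "y = 0")
        case True
        \<comment> \<open>The bound at \<open>y = 0\<close> yields the sign of
          \<open>F s\<close>.\<close>
        from elim(1) Ce have "0 \<le> e / C * F s" by force
        with Ce True show ?thesis by (simp add: zero_le_mult_iff zero_le_divide_iff)
      next
        case False
        then have "s < s + y" using y by auto
        from MVT2[OF this, of l F] deriv elim(2)
        obtain z where z: "s < z" "z < s + y" "l (s + y) - l s = (s + y - s) * F z"
          by (auto simp: less_le_trans)
        then have *: "\<bar>F (s + (z - s)) - F s\<bar> \<le> e / C * F s"
          using elim(1) y by (intro bspec[OF elim(1)]) auto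
        have "l (s + y) - l s - (0 + y) * F s = y * (F z - F s)"
          using z(3) by (simp add: algebra_simps)
        then have "\<bar>l (s + y) - l s - (0 + y) * F s\<bar> = y * \<bar>F z - F s\<bar>"
          using y by (simp add: abs_mult)
        also have "\<dots> \<le> C * (e / C * F s)"
          using * y by (intro mult_mono) auto
        finally show ?thesis using Ce by simp
      qed
    qed
  qed
qed

text \<open>All shifts in \<open>first_order\<close> go to the right, so it sees only the tails.
  This allows \<open>l\<close> to be altered far to the left later on.\<close>

lemma first_order_cong:
  assumes "first_order l F U M" "\<forall>\<^sub>F s in at_top. l s = l' s" "\<forall>\<^sub>F s in at_top. U s = U' s"
  shows "first_order l' F U' M"
  unfolding first_order_def
proof (intro allI impI)
  fix C e :: real assume Ce: "C > 0" "e > 0"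
  from assms(3) obtain a where a: "\<And>s. s \<ge> a \<Longrightarrow> U s = U' s"
    by (auto simp: eventually_at_top_linorder)
  from first_orderD[OF assms(1) Ce] assms(2) eventually_ge_at_top[of a]
  show "\<forall>\<^sub>F s in at_top. \<forall>y\<in>{0..C}. \<bar>U' (s + y) - l' s - (M + y) * F s\<bar> \<le> e * F s"
    by eventually_elim (auto simp: a)
qed

lemma tendsto_at_top_of_deriv_ge:
  fixes l F :: "real \<Rightarrow> real"
  assumes deriv: "\<And>s. s > a \<Longrightarrow> (l has_real_derivative F s) (at s)"
    and ge: "\<And>s. s > a \<Longrightarrow> F s \<ge> L" and "L > 0"
  shows "filterlim l at_top at_top"
proof (rule filterlim_at_top_mono)
  show "filterlim (\<lambda>s. l (a + 1) + (s - (a + 1)) * L) at_top at_top"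
    using \<open>L > 0\<close> by real_asymp
  show "\<forall>\<^sub>F s in at_top. l (a + 1) + (s - (a + 1)) * L \<le> l s"
    using eventually_gt_at_top[of "a + 1"]
  proof eventually_elim
    case (elim s)
    from MVT2[OF this, of l F] deriv
    obtain z where z: "a + 1 < z" "z < s" "l s - l (a + 1) = (s - (a + 1)) * F z"
      by (auto simp: less_le_trans)
    have "(s - (a + 1)) * L \<le> (s - (a + 1)) * F z"
      using elim ge[of z] z by (intro mult_left_mono) auto
    with z show ?case by linarith
  qed
qed

lemma slow_of_tendsto:
  fixes F :: "real \<Rightarrow> real"
  assumes "(F \<longlongrightarrow> L) at_top" "L > 0" "C > 0" "e > 0"
  shows "\<forall>\<^sub>F s in at_top. \<forall>y\<in>{0..C}. \<bar>F (s + y) - F s\<bar> \<le> e * F s"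
proof -
  \<comment> \<open>Two values within \<open>d\<close> of \<open>L\<close> differ by at most
    \<open>2 * d\<close>, which is at most \<open>e * (L / 2)\<close>; the first bound on
    \<open>d\<close> makes \<open>F s\<close> at least \<open>L / 2\<close>.\<close>
  define d where "d = min (L / 2) (e * L / 4)"
  have d: "d > 0" "d \<le> L / 2" "d \<le> e * L / 4" using assms by (auto simp: d_def)
  from tendstoD[OF assms(1) d(1)] obtain a where a: "\<And>s. s \<ge> a \<Longrightarrow> \<bar>F s - L\<bar> < d"
    by (auto simp: eventually_at_top_linorder dist_real_def)
  show ?thesis
    using eventually_ge_at_top[of a]
  proof eventually_elim
    case (elim s)
    have "\<bar>F (s + y) - F s\<bar> \<le> e * F s" if "y \<in> {0..C}" for y
    proof -
      have "\<bar>F (s + y) - L\<bar> < d" "\<bar>F s - L\<bar> < d" using a[of "s + y"] a[of s] that elim by auto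
      then have "\<bar>F (s + y) - F s\<bar> \<le> 2 * d" "F s \<ge> L / 2" using d by linarith+
      moreover have "e * (L / 2) \<le> e * F s"
        using \<open>F s \<ge> L / 2\<close> assms by (intro mult_left_mono) auto
      ultimately show ?thesis using d by linarith
    qed
    then show ?case by blast
  qed
qed

text \<open>The derivative of \<open>F\<close> between \<open>s\<close> and \<open>s + y\<close> is
  at most \<open>d * F (s + y)\<close>, as \<open>F\<close> increases. So the increment is bounded
  by a small multiple of the later value \<open>F (s + y)\<close>. With factor 1/2 this gives
  \<open>F (s + y) \<le> 2 * F s\<close>, and reinserting that turns the bound into a multiple of
  \<open>F s\<close>.\<close>

lemma slow_of_log_deriv:
  fixes F F' :: "real \<Rightarrow> real"
  assumes deriv: "\<And>s. s > a \<Longrightarrow> (F has_real_derivative F' s) (at s)"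
    and pos: "\<And>s. s > a \<Longrightarrow> F s > 0"
    and mono: "\<And>s t. a < s \<Longrightarrow> s \<le> t \<Longrightarrow> F s \<le> F t"
    and lim: "((\<lambda>s. F' s / F s) \<longlongrightarrow> 0) at_top" and "C > 0" "e > 0"
  shows "\<forall>\<^sub>F s in at_top. \<forall>y\<in>{0..C}. \<bar>F (s + y) - F s\<bar> \<le> e * F s"
proof -
  define d where "d = min (1 / 2) (e / 2) / C"
  have d: "d > 0" "C * d \<le> 1 / 2" "C * d \<le> e / 2" using assms by (auto simp: d_def)
  from tendstoD[OF lim d(1)] obtain b where b: "\<And>s. s \<ge> b \<Longrightarrow> \<bar>F' s / F s\<bar> < d"
    by (auto simp: eventually_at_top_linorder dist_real_def)
  show ?thesis
    using eventually_gt_at_top[of "max a b"]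
  proof eventually_elim
    case (elim s)
    have "\<bar>F (s + y) - F s\<bar> \<le> e * F s" if y: "y \<in> {0..C}" for y
    proof (cases "y = 0")
      case True
      then show ?thesis using pos[of s] elim \<open>e > 0\<close> by (auto intro: mult_nonneg_nonneg)
    next
      case False
      then have "s < s + y" using y by auto
      from MVT2[OF this, of F F'] deriv elim
      obtain z where z: "s < z" "z < s + y" "F (s + y) - F s = (s + y - s) * F' z"
        by (auto simp: less_le_trans)
      have "\<bar>F' z\<bar> < d * F z"
        using b[of z] pos[of z] z elim by (simp add: abs_divide divide_less_eq)
      also have "\<dots> \<le> d * F (s + y)"
        using mono[of z "s + y"] d z elim by (intro mult_left_mono) auto
      finally have "y * \<bar>F' z\<bar> \<le> C * (d * F (s + y))"
        using y by (intro mult_mono) auto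
      moreover have "y * F' z \<le> y * \<bar>F' z\<bar>" using y by (intro mult_left_mono) auto
      ultimately have "y * F' z \<le> C * (d * F (s + y))" by linarith
      then have *: "F (s + y) - F s \<le> (C * d) * F (s + y)" using z by simp
      also have "\<dots> \<le> 1 / 2 * F (s + y)"
        using d pos[of "s + y"] y elim by (intro mult_right_mono) auto
      finally have "F (s + y) \<le> 2 * F s" by simp
      then have "(C * d) * F (s + y) \<le> (e / 2) * (2 * F s)"
        using d pos[of "s + y"] y elim \<open>e > 0\<close> by (intro mult_mono) auto
      moreover have "F s \<le> F (s + y)" using mono[of s "s + y"] y elim by auto
      ultimately show ?thesis using * by simp
    qed
    then show ?case by blast
  qed
qed

section \<open>From the risk function to a loss with slowly varying slope\<close>

lemma C1_differentiable_on_deriv: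
  fixes f :: "real \<Rightarrow> real"
  assumes "f C1_differentiable_on S" "x \<in> S"
  shows "(f has_real_derivative deriv f x) (at x)"
  using assms unfolding C1_differentiable_on_def
  by (metis DERIV_imp_deriv has_real_derivative_iff_has_vector_derivative)

text \<open>Strict monotonicity alone would allow a zero derivative. A concave function lies below
  its tangents, and the tangent at \<open>x\<close> must rise to reach the larger value at a point
  between \<open>x\<close> and \<open>b\<close>. Adding the tangent inequalities at two points shows
  that the derivative decreases.\<close>

lemma strict_mono_concave_deriv:
  fixes f :: "real \<Rightarrow> real"
  assumes mono: "strict_mono_on {..<b} f" and conc: "concave_on {..<b} f"
    and deriv: "\<And>x. x < b \<Longrightarrow> (f has_real_derivative f' x) (at x)"
  shows "\<And>x. x < b \<Longrightarrow> f' x > 0" and "\<And>x y. x \<le> y \<Longrightarrow> y < b \<Longrightarrow> f' y \<le> f' x"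
proof -
  have tangent: "f y - f x \<le> f' x * (y - x)" if "x < b" "y < b" for x y
  proof -
    have "((\<lambda>x. - f x) has_real_derivative - f' x) (at x within {..<b})"
      using deriv[OF that(1)] by (auto intro: DERIV_minus has_field_derivative_at_within)
    from convex_on_imp_above_tangent[of "{..<b}" "\<lambda>x. - f x", OF _ _ _ _ this, of y] that conc
    have "- f' x * (y - x) \<le> - f y - - f x" by (simp add: concave_on_def interior_open)
    then show ?thesis by simp
  qed
  show "f' x > 0" if "x < b" for x
  proof -
    have "0 < f' x * ((x + b) / 2 - x)"
      using tangent[of x "(x + b) / 2"] strict_mono_onD[OF mono, of x "(x + b) / 2"] that by auto
    with that show ?thesis by (simp add: zero_less_mult_iff)
  qed
  show "f' y \<le> f' x" if "x \<le> y" "y < b" for x y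
  proof (cases "x = y")
    case False
    have "(f' y - f' x) * (y - x) \<le> 0"
      using tangent[of x y] tangent[of y x] that by (simp add: algebra_simps)
    with False that show ?thesis by (simp add: mult_le_0_iff)
  qed simp
qed

text \<open>Both alternatives of Case 1 are reduced to one interface. The hypotheses on
  \<open>f\<close> speak of a half-line only, so the loss is frozen to the left of a point
  \<open>s0\<close>; this makes it continuous and monotone everywhere. The lower bound 1, rather
  than 0, leaves room to subtract a slack of at most 1 without losing nonnegativity.\<close>

lemma loss_of_risk_function:
  fixes f :: "real \<Rightarrow> real"
  assumes "strict_mono_on {..<T1} f \<and> concave_on {..<T1} f \<and>
         f C1_differentiable_on {..<T1} \<and> deriv f C1_differentiable_on {..<T1} \<and>
         ((\<lambda>t. deriv (deriv f) t / deriv f t) \<longlongrightarrow> 0) at_bot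
       \<or> f C1_differentiable_on {..<T1} \<and> (\<exists>L>0. (deriv f \<longlongrightarrow> L) at_bot)"
  obtains l F s0 where "continuous_on UNIV l" "mono l" "\<And>s. 1 \<le> l s" "filterlim l at_top at_top"
    "\<forall>\<^sub>F s in at_top. F s > 0" "first_order l F l 0" "\<And>s. s \<ge> s0 \<Longrightarrow> l s = - f (- s)"
proof -
  define k F where "k s = - f (- s)" and "F s = deriv f (- s)" for s
  have "\<forall>x<T1. (f has_real_derivative deriv f x) (at x)"
    using assms by (auto intro: C1_differentiable_on_deriv)
  then have k: "(k has_real_derivative F s) (at s)" if "s > - T1" for s
    unfolding k_def F_def using that DERIV_minus[OF DERIV_mirror[THEN iffD1]] by force
  \<comment> \<open>A positive lower bound \<open>L\<close> of the slope makes the loss tend to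
    infinity. In the concave case \<open>F\<close> increases, so its value at one point is such a
    bound.\<close>
  have "\<exists>a L. a \<ge> - T1 \<and> L > 0 \<and> (\<forall>s>a. F s \<ge> L) \<and>
    (\<forall>C>0. \<forall>e>0. \<forall>\<^sub>F s in at_top. \<forall>y\<in>{0..C}. \<bar>F (s + y) - F s\<bar> \<le> e * F s)"
    using assms
  proof (elim disjE conjE exE)
    fix L :: real assume L: "L > 0" "(deriv f \<longlongrightarrow> L) at_bot"
    then have F: "(F \<longlongrightarrow> L) at_top"
      unfolding F_def[abs_def] by (simp only: filterlim_at_bot_mirror)
    from order_tendstoD(1)[OF this, of "L / 2"] L obtain b where "\<And>s. s \<ge> b \<Longrightarrow> F s > L / 2"
      by (auto simp: eventually_at_top_linorder)
    with slow_of_tendsto[OF F] L show ?thesis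
      by (intro exI[of _ "max b (- T1)"] exI[of _ "L / 2"]) (auto simp: less_imp_le)
  next
    assume A: "strict_mono_on {..<T1} f" "concave_on {..<T1} f" "f C1_differentiable_on {..<T1}"
      "deriv f C1_differentiable_on {..<T1}" "((\<lambda>t. deriv (deriv f) t / deriv f t) \<longlongrightarrow> 0) at_bot"
    from A(3) have df: "\<And>x. x < T1 \<Longrightarrow> (f has_real_derivative deriv f x) (at x)"
      by (auto intro: C1_differentiable_on_deriv)
    have pos: "F s > 0" if "s > - T1" for s
      unfolding F_def using strict_mono_concave_deriv(1)[OF A(1,2) df, of "- s"] that by auto
    have mono: "F s \<le> F t" if "s > - T1" "s \<le> t" for s t
      unfolding F_def using strict_mono_concave_deriv(2)[OF A(1,2) df, of "- t" "- s"] that by auto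
    have "(F has_real_derivative - deriv (deriv f) (- s)) (at s)" if "s > - T1" for s
      unfolding F_def using C1_differentiable_on_deriv[OF A(4), of "- s"] that
      by (simp add: DERIV_mirror)
    moreover have "((\<lambda>s. - deriv (deriv f) (- s) / F s) \<longlongrightarrow> 0) at_top"
      using tendsto_minus[OF A(5)] unfolding F_def by (simp add: filterlim_at_bot_mirror)
    ultimately have "\<forall>\<^sub>F s in at_top. \<forall>y\<in>{0..C}. \<bar>F (s + y) - F s\<bar> \<le> e * F s"
      if "C > 0" "e > 0" for C e
      using pos mono that by (intro slow_of_log_deriv[of "- T1" F]) auto
    then show ?thesis
      using pos[of "- T1 + 1"] mono[of "- T1 + 1"]
      by (intro exI[of _ "- T1 + 1"] exI[of _ "F (- T1 + 1)"]) auto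
  qed
  then obtain a L where aL: "a \<ge> - T1" "L > 0" "\<And>s. s > a \<Longrightarrow> F s \<ge> L"
    and slow: "\<And>C e. C > 0 \<Longrightarrow> e > 0 \<Longrightarrow> \<forall>\<^sub>F s in at_top. \<forall>y\<in>{0..C}. \<bar>F (s + y) - F s\<bar> \<le> e * F s"
    by blast
  have ka: "(k has_real_derivative F s) (at s)" if "s > a" for s
    using k aL that by auto
  have klim: "filterlim k at_top at_top"
    by (rule tendsto_at_top_of_deriv_ge[OF ka aL(3,2)])
  then have "\<forall>\<^sub>F s in at_top. k s \<ge> 1" by (simp add: filterlim_at_top)
  then obtain s1 where s1: "\<And>s. s \<ge> s1 \<Longrightarrow> k s \<ge> 1" by (auto simp: eventually_at_top_linorder)
  \<comment> \<open>From \<open>s1\<close> on the loss is at least 1, and beyond \<open>a\<close> it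
    is differentiable; the added 1 keeps the closed half-line from \<open>s0\<close> inside that
    open range.\<close>
  define s0 where "s0 = max s1 (a + 1)"
  define l where "l s = k (max s s0)" for s
  have l_eq: "l s = k s" if "s \<ge> s0" for s using that by (simp add: l_def)
  have ev: "\<forall>\<^sub>F s in at_top. k s = l s"
    using eventually_ge_at_top[of s0] by eventually_elim (simp add: l_eq)
  show thesis
  proof
    show "continuous_on UNIV l"
      unfolding l_def[abs_def]
    proof (rule continuous_on_compose2[where f="\<lambda>s. max s s0" and t="{s0..}"])
      show "continuous_on {s0..} k"
        by (rule DERIV_continuous_on[where D=F], rule has_field_derivative_at_within, rule ka)
          (auto simp: s0_def)
    qed (auto intro!: continuous_intros)
    have "k x \<le> k y" if "s0 \<le> x" "x \<le> y" for x y
      using that(2)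
    proof (rule DERIV_nonneg_imp_nondecreasing)
      fix z assume "x \<le> z"
      with that(1) have "z > a" by (simp add: s0_def)
      with ka[OF this] aL(2) aL(3)[OF this]
      show "\<exists>w. (k has_real_derivative w) (at z) \<and> 0 \<le> w" by (intro exI[of _ "F z"]) auto
    qed
    then show "mono l" by (auto simp: mono_def l_def)
    show "1 \<le> l s" for s unfolding l_def by (rule s1) (simp add: s0_def)
    show "filterlim l at_top at_top" by (rule filterlim_cong[OF refl refl ev, THEN iffD1, OF klim])
    show "\<forall>\<^sub>F s in at_top. F s > 0"
      using eventually_gt_at_top[of a] by eventually_elim (use aL in force)
    show "first_order l F l 0"
      using first_order_self[OF ka slow] ev ev by (rule first_order_cong) auto
    show "l s = - f (- s)" if "s \<ge> s0" for s using l_eq[OF that] by (simp add: k_def)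
  qed
qed

section \<open>Worst-case mean distances\<close>

context robust_routing begin

definition dist_to :: "'v \<Rightarrow> real" where "dist_to i = real_of_ereal (worst_dist N i)"

lemma ambiguity_arc:
  assumes "a \<in> parcs (graph N)" "p \<in> ambiguity N a"
  shows "real_distribution p" "measure p {lower N a..upper N a} = 1" "prob_space p"
    "sets p = sets borel" "AE x in p. x \<in> {lower N a..upper N a}"
proof -
  show p: "real_distribution p" "measure p {lower N a..upper N a} = 1"
    using ambiguity_subset[OF assms(1)] assms(2) by (auto simp: prob_measures_on_def)
  then interpret real_distribution p by simp
  show "prob_space p" "sets p = sets borel" by unfold_locales simp
  show "AE x in p. x \<in> {lower N a..upper N a}"
    using p(2) by (subst prob_eq_1[symmetric]) auto
qed

lemma arc_lower_pos: "a \<in> parcs (graph N) \<Longrightarrow> 0 < lower N a"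
  and arc_lower_le_upper: "a \<in> parcs (graph N) \<Longrightarrow> lower N a \<le> upper N a"
  using cost_bounds by auto

lemma finite_arcs: "finite (parcs (graph N))" and finite_verts: "finite (pverts (graph N))"
  by auto

lemma integrable_continuous:
  assumes a: "a \<in> parcs (graph N)" "p \<in> ambiguity N a" and g: "continuous_on UNIV (g :: real \<Rightarrow> real)"
  shows "integrable p g"
proof -
  interpret real_distribution p by (rule ambiguity_arc[OF a])
  have "bounded (g ` {lower N a..upper N a})"
    by (intro compact_imp_bounded compact_continuous_image continuous_on_subset[OF g]) auto
  then obtain B where B: "\<And>x. x \<in> {lower N a..upper N a} \<Longrightarrow> norm (g x) \<le> B"
    unfolding bounded_iff by (metis imageI)
  show ?thesis
  proof (rule integrable_const_bound[where B=B])
    show "AE x in p. norm (g x) \<le> B" using ambiguity_arc(5)[OF a] by eventually_elim (rule B)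
    show "g \<in> borel_measurable p"
      using borel_measurable_continuous_onI[OF g] measurable_cong_sets[OF ambiguity_arc(4)[OF a] refl] by blast
  qed
qed

lemma integral_mono_arc:
  assumes a: "a \<in> parcs (graph N)" "p \<in> ambiguity N a"
    and g: "continuous_on UNIV (g :: real \<Rightarrow> real)" "continuous_on UNIV (k :: real \<Rightarrow> real)"
    and le: "\<And>x. x \<in> {lower N a..upper N a} \<Longrightarrow> g x \<le> k x"
  shows "(\<integral>x. g x \<partial>p) \<le> (\<integral>x. k x \<partial>p)"
  by (intro integral_mono_AE integrable_continuous[OF a] g eventually_mono[OF ambiguity_arc(5)[OF a] le])

lemma integral_const_arc:
  assumes "a \<in> parcs (graph N)" "p \<in> ambiguity N a"
  shows "(\<integral>x. (c :: real) \<partial>p) = c"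
  using prob_space.prob_space[OF ambiguity_arc(3)[OF assms]] by (simp only: lebesgue_integral_const) simp

lemma mean_le_worst_mean:
  assumes "a \<in> parcs (graph N)" "p \<in> ambiguity N a"
  shows "(\<integral>x. x \<partial>p) \<le> worst_mean N a"
  unfolding worst_mean_def
proof (rule cSUP_upper[OF assms(2)])
  have "(\<integral>x. x \<partial>q) \<le> upper N a" if "q \<in> ambiguity N a" for q
    using integral_mono_arc[OF assms(1) that, of "\<lambda>x. x" "\<lambda>_. upper N a"]
    unfolding integral_const_arc[OF assms(1) that] by simp
  then show "bdd_above ((\<lambda>p. \<integral>x. x \<partial>p) ` ambiguity N a)" by (auto intro!: bdd_aboveI)
qed

lemma worst_mean_le:
  assumes "a \<in> parcs (graph N)" "\<And>p. p \<in> ambiguity N a \<Longrightarrow> (\<integral>x. x \<partial>p) \<le> B"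
  shows "worst_mean N a \<le> B"
  unfolding worst_mean_def using assms(2) by (rule cSUP_least[OF ambiguity_nonempty[OF assms(1)]])

lemma worst_mean_pos: assumes a: "a \<in> parcs (graph N)" shows "0 < worst_mean N a"
proof -
  obtain p where p: "p \<in> ambiguity N a" using ambiguity_nonempty[OF a] by auto
  have "lower N a \<le> (\<integral>x. x \<partial>p)"
    using integral_mono_arc[OF a p, of "\<lambda>_. lower N a" "\<lambda>x. x"]
    unfolding integral_const_arc[OF a p] by simp
  with mean_le_worst_mean[OF a p] arc_lower_pos[OF a] show ?thesis by linarith
qed

lemma worst_dist_nonneg: "0 \<le> worst_dist N i"
  unfolding worst_dist_def G.\<mu>_def
proof (rule INF_greatest)
  fix p assume "p \<in> {p. G.awalk i p (dest N)}"
  then have "0 \<le> G.awalk_cost (worst_mean N) p"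
    using worst_mean_pos by (intro G.pos_cost_pos_awalk_cost[of i p "dest N"]) (auto simp: less_imp_le)
  then show "0 \<le> ereal (G.awalk_cost (worst_mean N) p)" by simp
qed

lemma worst_dist_eq: "i \<in> pverts (graph N) \<Longrightarrow> worst_dist N i = ereal (dist_to i)"
  unfolding dist_to_def using worst_dist_finite[of i] worst_dist_nonneg[of i]
  by (cases "worst_dist N i") auto

lemma arc_verts: "(i, j) \<in> parcs (graph N) \<Longrightarrow> i \<in> pverts (graph N) \<and> j \<in> pverts (graph N)"
  using G.in_arcsD1 G.in_arcsD2 by blast

lemma dist_to_dest: "dist_to (dest N) = 0"
proof -
  have "worst_dist N (dest N) \<le> ereal (G.awalk_cost (worst_mean N) [])"
    unfolding worst_dist_def by (rule G.min_cost_le_walk_cost) (simp add: G.awalk_Nil_iff dest_in)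
  then have "worst_dist N (dest N) = 0" using worst_dist_nonneg[of "dest N"] by (simp add: zero_ereal_def)
  then show ?thesis by (simp add: dist_to_def)
qed

lemma dist_to_arc_le:
  assumes a: "(i, j) \<in> parcs (graph N)"
  shows "dist_to i \<le> worst_mean N (i, j) + dist_to j"
proof -
  have "worst_dist N i - ereal (worst_mean N (i, j)) \<le> worst_dist N j"
    unfolding worst_dist_def[of N j] G.\<mu>_def
  proof (rule INF_greatest)
    fix p assume "p \<in> {p. G.awalk j p (dest N)}"
    then have "G.awalk i ((i, j) # p) (dest N)" using a by (simp add: G.awalk_Cons_iff)
    from G.min_cost_le_walk_cost[OF this, of "worst_mean N"] a
    show "worst_dist N i - ereal (worst_mean N (i, j)) \<le> ereal (G.awalk_cost (worst_mean N) p)"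
      by (simp add: worst_dist_eq arc_verts flip: worst_dist_def) 
  qed
  with arc_verts[OF a] show ?thesis by (simp add: worst_dist_eq)
qed

lemma tree_successors_iff:
  assumes "(i, j) \<in> parcs (graph N)"
  shows "j \<in> tree_successors N i \<longleftrightarrow> worst_mean N (i, j) + dist_to j = dist_to i"
  using assms arc_verts[OF assms] by (auto simp: tree_successors_def worst_dist_eq)

lemma tree_successors_arc: "j \<in> tree_successors N i \<Longrightarrow> (i, j) \<in> parcs (graph N)"
  by (auto simp: tree_successors_def)

lemma finite_successors: "finite (successors N i)"
  by (rule finite_subset[of _ "snd ` parcs (graph N)"]) force+

lemma finite_tree_successors: "finite (tree_successors N i)"
  by (rule finite_subset[OF _ finite_successors]) (auto simp: tree_successors_def)

text \<open>The distance is an infimum over possibly infinitely many walks, but only finitely many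
  first arcs occur. Every walk to the destination costs at least its first arc plus the distance
  from there, so the smallest such sum is a lower bound for all walks and its arc attains the
  distance. Finiteness of the distance supplies a walk, hence a first arc.\<close>

lemma tree_successors_nonempty:
  assumes i: "i \<in> pverts (graph N)" "i \<noteq> dest N"
  shows "tree_successors N i \<noteq> {}"
proof -
  define b where "b j = worst_mean N (i, j) + dist_to j" for j
  have walk: "\<exists>j\<in>successors N i. b j \<le> G.awalk_cost (worst_mean N) p"
    if p: "G.awalk i p (dest N)" for p
  proof (cases p)
    case Nil
    with p i show ?thesis by (simp add: G.awalk_Nil_iff)
  next
    case (Cons a q)
    with p have a: "a \<in> parcs (graph N)" "i = fst a" "G.awalk (snd a) q (dest N)"
      by (auto simp: G.awalk_Cons_iff)
    from G.min_cost_le_walk_cost[OF a(3), of "worst_mean N"] a(1,2) arc_verts[of i "snd a"]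
    have "dist_to (snd a) \<le> G.awalk_cost (worst_mean N) q"
      by (simp add: worst_dist_eq flip: worst_dist_def)
    with a Cons show ?thesis by (intro bexI[of _ "snd a"]) (auto simp: b_def)
  qed
  have "{p. G.awalk i p (dest N)} \<noteq> {}"
    using worst_dist_finite[OF i(1)] unfolding worst_dist_def G.\<mu>_reach_conv G.reachable_awalk by auto
  with walk have "successors N i \<noteq> {}" by blast
  then obtain j where j: "j \<in> successors N i" "\<And>k. k \<in> successors N i \<Longrightarrow> b j \<le> b k"
    using finite_successors[of i] by (metis (no_types, lifting) arg_min_least arg_min_if_finite(1))
  have "ereal (b j) \<le> worst_dist N i"
    unfolding worst_dist_def G.\<mu>_def
    using walk j(2) by (intro INF_greatest) (force intro: order_trans)
  then have "b j \<le> dist_to i" using i by (simp add: worst_dist_eq)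
  with dist_to_arc_le[of i j] j(1) have "j \<in> tree_successors N i"
    by (simp add: tree_successors_iff b_def)
  then show ?thesis by blast
qed

definition tree_rel :: "('v \<times> 'v) set" where
  "tree_rel = {(j, i). j \<in> tree_successors N i}"

text \<open>Worst-case means are positive, so the distance falls along every tree arc, although the
  graph itself may have cycles. On finitely many vertices the number of strictly closer vertices is
  a rank.\<close>

lemma wf_tree_rel: "wf tree_rel"
proof -
  define r where "r i = card {k \<in> pverts (graph N). dist_to k < dist_to i}" for i
  have "r j < r i" if "j \<in> tree_successors N i" for i j
  proof -
    have "dist_to j < dist_to i" "j \<in> pverts (graph N)"
      using that tree_successors_arc[OF that] worst_mean_pos[of "(i, j)"] arc_verts
      by (auto simp: tree_successors_iff)
    then show ?thesis unfolding r_def by (intro psubset_card_mono) auto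
  qed
  then have "tree_rel \<subseteq> Wellfounded.measure r" by (auto simp: tree_rel_def)
  then show ?thesis by (rule wf_subset[OF wf_measure])
qed

end

section \<open>Backward induction along the tree\<close>

text \<open>The modulus \<open>d\<close> does not depend on the cost \<open>c\<close>. It therefore
  survives integration against every distribution of an ambiguity set simultaneously, and so the
  supremum over that set.\<close>

lemma continuous_on_uniform_shift:
  fixes U :: "real \<Rightarrow> real"
  assumes U: "continuous_on UNIV U" and "e > 0"
  obtains d where "d > 0" "\<And>t c. \<bar>t - s\<bar> < d \<Longrightarrow> c \<in> {a..b} \<Longrightarrow> \<bar>U (t + c) - U (s + c)\<bar> \<le> e"
proof -
  have "uniformly_continuous_on {s - 1 + a..s + 1 + b} U"
    by (intro compact_uniformly_continuous continuous_on_subset[OF U]) auto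
  from uniformly_continuous_onE[OF this \<open>e > 0\<close>] obtain d where d: "d > 0"
    "\<And>x y. x \<in> {s - 1 + a..s + 1 + b} \<Longrightarrow> y \<in> {s - 1 + a..s + 1 + b} \<Longrightarrow>
      dist y x < d \<Longrightarrow> dist (U y) (U x) < e"
    by metis
  \<comment> \<open>With \<open>d\<close> capped at 1, both arguments of \<open>U\<close> stay in
    the compact interval \<open>{a..b}\<close> shifted by \<open>s\<close> and widened by 1.\<close>
  show thesis
  proof (rule that[of "min d 1"])
    fix t c assume tc: "\<bar>t - s\<bar> < min d 1" "c \<in> {a..b}"
    then have "s + c \<in> {s - 1 + a..s + 1 + b}" "t + c \<in> {s - 1 + a..s + 1 + b}"
      by (auto simp: abs_less_iff)
    from d(2)[OF this] tc show "\<bar>U (t + c) - U (s + c)\<bar> \<le> e" by (simp add: dist_real_def)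
  qed (use d in auto)
qed

lemma continuous_on_Min_image:
  fixes g :: "'b \<Rightarrow> real \<Rightarrow> real"
  assumes "finite A" "A \<noteq> {}" "\<And>j. j \<in> A \<Longrightarrow> continuous_on UNIV (g j)"
  shows "continuous_on UNIV (\<lambda>s. MIN j\<in>A. g j s)"
  using assms by (induction rule: finite_ne_induct) (auto intro!: continuous_intros)

lemma first_order_Min_image:
  assumes "finite A" "A \<noteq> {}" "\<And>j. j \<in> A \<Longrightarrow> first_order l F (g j) M"
  shows "first_order l F (\<lambda>s. MIN j\<in>A. g j s) M"
  unfolding first_order_def
proof (intro allI impI)
  fix C e :: real assume Ce: "C > 0" "e > 0"
  have "\<forall>\<^sub>F s in at_top. \<forall>j\<in>A. \<forall>y\<in>{0..C}. \<bar>g j (s + y) - l s - (M + y) * F s\<bar> \<le> e * F s"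
    using assms Ce by (intro eventually_ball_finite first_orderD ballI)
  then show "\<forall>\<^sub>F s in at_top. \<forall>y\<in>{0..C}. \<bar>(MIN j\<in>A. g j (s + y)) - l s - (M + y) * F s\<bar> \<le> e * F s"
  proof eventually_elim
    case (elim s)
    show ?case
    proof
      fix y assume "y \<in> {0..C}"
      have "(MIN j\<in>A. g j (s + y)) \<in> (\<lambda>j. g j (s + y)) ` A"
        using assms by (intro Min_in) auto
      then obtain j where "j \<in> A" "(MIN j\<in>A. g j (s + y)) = g j (s + y)" by auto
      with elim \<open>y \<in> {0..C}\<close> show "\<bar>(MIN j\<in>A. g j (s + y)) - l s - (M + y) * F s\<bar> \<le> e * F s"
        by simp
    qed
  qed
qed

lemma first_order_less:
  assumes U: "first_order l F U M" and V: "first_order l F V M'" and "M < M'"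
    and F: "\<forall>\<^sub>F s in at_top. F s > 0"
  shows "\<forall>\<^sub>F s in at_top. U s < V s"
proof -
  \<comment> \<open>Each expansion errs by at most \<open>e * F s\<close>, so a third of the gap
    remains.\<close>
  define e where "e = (M' - M) / 3"
  have e: "e > 0" using assms by (simp add: e_def)
  from first_orderD[OF U zero_less_one e] first_orderD[OF V zero_less_one e] F
  show ?thesis
  proof eventually_elim
    case (elim s)
    have "\<bar>U s - l s - M * F s\<bar> \<le> e * F s" "\<bar>V s - l s - M' * F s\<bar> \<le> e * F s"
      using elim(1,2) by (force dest: bspec[where x=0])+
    moreover have "M' * F s = M * F s + 3 * (e * F s)" by (simp add: e_def field_simps)
    moreover have "e * F s > 0" using e elim by simp
    ultimately show ?case by linarith
  qed
qed

text \<open>This supplies the domination of the node losses by a multiple of \<open>l\<close>. Since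
  \<open>U\<close> is \<open>l\<close> plus a multiple of \<open>F\<close> up to a small error, it
  suffices that \<open>F\<close> is bounded by a multiple of \<open>l\<close>: the increments of
  \<open>l\<close> over unit intervals are comparable to \<open>F\<close>, and they are at most
  \<open>l\<close> itself.\<close>

lemma first_order_bigo:
  assumes l: "first_order l F l 0" "mono l" "\<And>s. 0 \<le> l s" and F: "\<forall>\<^sub>F s in at_top. F s > 0"
    and U: "first_order l F U M"
  shows "\<exists>K. \<forall>\<^sub>F s in at_top. U s \<le> K * l s"
proof
  define G where "G s \<longleftrightarrow> (\<forall>y\<in>{0..2}. \<bar>l (s + y) - l s - y * F s\<bar> \<le> 1 / 2 * F s) \<and> F s > 0" for s
  have "\<forall>\<^sub>F s in at_top. G s"
    using first_orderD[OF l(1), of 2 "1 / 2"] F by (auto simp: G_def eventually_conj_iff)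
  then obtain a where a: "\<And>s. s \<ge> a \<Longrightarrow> G s" by (auto simp: eventually_at_top_linorder)
  \<comment> \<open>Half of \<open>F s\<close> is at most \<open>l (s + 1) - l s\<close>, hence at
    most \<open>l (s + 1) - l (s - 1)\<close>, hence at most \<open>5 / 2 * F (s - 1)\<close>. The
    latter is at most 5 times \<open>l s - l (s - 1)\<close>, so at most
    \<open>5 * l s\<close>.\<close>
  have bound: "F s \<le> 10 * l s" if "s \<ge> a + 1" for s
  proof -
    have "G s" "G (s - 1)" using a that by auto
    then have "l (s + 1) - l s \<ge> 1 / 2 * F s" "l (s - 1 + 1) - l (s - 1) \<ge> 1 / 2 * F (s - 1)"
      "l (s - 1 + 2) - l (s - 1) \<le> 5 / 2 * F (s - 1)"
      using bspec[OF conjunct1[OF \<open>G s\<close>[unfolded G_def]], of 1]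
        bspec[OF conjunct1[OF \<open>G (s - 1)\<close>[unfolded G_def]], of 1]
        bspec[OF conjunct1[OF \<open>G (s - 1)\<close>[unfolded G_def]], of 2]
      unfolding abs_le_iff by auto
    moreover have "l s - l (s - 1) \<le> l s" "0 \<le> l (s - 1)" "l (s - 1) \<le> l s"
      using l(3) by (auto intro: monoD[OF l(2)])
    ultimately show ?thesis by (simp add: algebra_simps)
  qed
  show "\<forall>\<^sub>F s in at_top. U s \<le> (1 + 10 * (\<bar>M\<bar> + 1)) * l s"
    using first_orderD[OF U zero_less_one zero_less_one] eventually_ge_at_top[of "a + 1"]
  proof eventually_elim
    case (elim s)
    have "\<bar>U s - l s - M * F s\<bar> \<le> F s" using elim(1) by (force dest: bspec[where x=0])
    moreover have "0 \<le> F s" using a[of s] elim by (simp add: G_def)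
    then have "M * F s \<le> \<bar>M\<bar> * F s" by (intro mult_right_mono) auto
    ultimately have "U s \<le> l s + (\<bar>M\<bar> + 1) * F s" by (simp add: algebra_simps)
    also have "(\<bar>M\<bar> + 1) * F s \<le> (\<bar>M\<bar> + 1) * (10 * l s)"
      using bound[OF elim(2)] by (intro mult_left_mono) auto
    finally show ?case by (simp add: algebra_simps)
  qed
qed

section \<open>The worst-case loss over a single arc\<close>

context robust_routing begin

definition arc_loss :: "'v \<times> 'v \<Rightarrow> (real \<Rightarrow> real) \<Rightarrow> real \<Rightarrow> real" where
  "arc_loss a U s = (SUP p\<in>ambiguity N a. \<integral>c. U (s + c) \<partial>p)"

context
  fixes a U
  assumes a: "a \<in> parcs (graph N)" and U: "continuous_on UNIV (U :: real \<Rightarrow> real)"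
begin

lemma continuous_shift: "continuous_on UNIV (\<lambda>c. U (s + c))"
  by (intro continuous_on_compose2[OF U] continuous_intros) auto

lemma integral_le_bound:
  assumes "p \<in> ambiguity N a" "\<And>c. c \<in> {lower N a..upper N a} \<Longrightarrow> U (s + c) \<le> B"
  shows "(\<integral>c. U (s + c) \<partial>p) \<le> B"
  using integral_mono_arc[OF a assms(1) continuous_shift, of "\<lambda>_. B" s] assms
  unfolding integral_const_arc[OF a assms(1)] by auto

lemma bdd_above_arc_loss: "bdd_above ((\<lambda>p. \<integral>c. U (s + c) \<partial>p) ` ambiguity N a)"
proof -
  have "bounded ((\<lambda>c. U (s + c)) ` {lower N a..upper N a})"
    by (intro compact_imp_bounded compact_continuous_image continuous_on_subset[OF continuous_shift]) auto
  then obtain B where B: "\<And>x. x \<in> {lower N a..upper N a} \<Longrightarrow> \<bar>U (s + x)\<bar> \<le> B"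
    unfolding bounded_iff by (metis imageI real_norm_def)
  then show ?thesis by (intro bdd_aboveI2[of _ _ B] integral_le_bound) (auto intro: order_trans[OF abs_ge_self B])
qed

lemma integral_le_arc_loss: "p \<in> ambiguity N a \<Longrightarrow> (\<integral>c. U (s + c) \<partial>p) \<le> arc_loss a U s"
  unfolding arc_loss_def by (rule cSUP_upper[OF _ bdd_above_arc_loss])

lemma arc_loss_le:
  "(\<And>p. p \<in> ambiguity N a \<Longrightarrow> (\<integral>c. U (s + c) \<partial>p) \<le> B) \<Longrightarrow> arc_loss a U s \<le> B"
  unfolding arc_loss_def by (rule cSUP_least[OF ambiguity_nonempty[OF a]])

lemma integral_shift_le:
  assumes "p \<in> ambiguity N a" and "\<And>c. c \<in> {lower N a..upper N a} \<Longrightarrow> U (s + c) \<le> U (t + c) + e"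
  shows "(\<integral>c. U (s + c) \<partial>p) \<le> (\<integral>c. U (t + c) \<partial>p) + e"
proof -
  interpret prob_space p by (rule ambiguity_arc[OF a assms(1)])
  have "(\<integral>c. U (s + c) \<partial>p) \<le> (\<integral>c. U (t + c) + e \<partial>p)"
    using assms by (intro integral_mono_arc[OF a assms(1)] continuous_on_add continuous_shift) auto
  also have "\<dots> = (\<integral>c. U (t + c) \<partial>p) + e"
    using integrable_continuous[OF a assms(1) continuous_shift, of t] by (simp add: prob_space)
  finally show ?thesis .
qed

lemma arc_loss_shift_le:
  assumes "\<And>c. c \<in> {lower N a..upper N a} \<Longrightarrow> U (s + c) \<le> U (t + c) + e"
  shows "arc_loss a U s \<le> arc_loss a U t + e"
  using integral_shift_le[OF _ assms] integral_le_arc_loss[of _ t] by (intro arc_loss_le) force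

lemma continuous_on_integral_shift:
  assumes p: "p \<in> ambiguity N a"
  shows "continuous_on UNIV (\<lambda>s. \<integral>c. U (s + c) \<partial>p)"
  unfolding continuous_on_iff
proof (intro ballI allI impI)
  fix s e :: real assume "e > 0"
  then have "e / 2 > 0" by simp
  from continuous_on_uniform_shift[OF U this, of s "lower N a" "upper N a"] obtain d where d: "d > 0"
    "\<And>t c. \<bar>t - s\<bar> < d \<Longrightarrow> c \<in> {lower N a..upper N a} \<Longrightarrow> \<bar>U (t + c) - U (s + c)\<bar> \<le> e / 2" by blast
  have "dist (\<integral>c. U (t + c) \<partial>p) (\<integral>c. U (s + c) \<partial>p) < e" if "dist t s < d" for t
  proof -
    have diff: "\<bar>U (t + c) - U (s + c)\<bar> \<le> e / 2" if "c \<in> {lower N a..upper N a}" for c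
      using d(2) that \<open>dist t s < d\<close> by (simp add: dist_real_def)
    then have close: "U (t + c) \<le> U (s + c) + e / 2" "U (s + c) \<le> U (t + c) + e / 2"
      if "c \<in> {lower N a..upper N a}" for c using diff[OF that] unfolding abs_le_iff by auto
    note integral_shift_le[OF p close(1)] integral_shift_le[OF p close(2)]
    with \<open>e > 0\<close> show ?thesis unfolding dist_real_def by linarith
  qed
  with d(1) show "\<exists>d>0. \<forall>t\<in>UNIV. dist t s < d \<longrightarrow> dist (\<integral>c. U (t + c) \<partial>p) (\<integral>c. U (s + c) \<partial>p) < e"
    by blast
qed

lemma continuous_on_arc_loss: "continuous_on UNIV (arc_loss a U)"
  unfolding continuous_on_iff
proof (intro ballI allI impI)
  fix s e :: real assume "e > 0"
  then have "e / 2 > 0" by simp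
  from continuous_on_uniform_shift[OF U this, of s "lower N a" "upper N a"] obtain d where d: "d > 0"
    "\<And>t c. \<bar>t - s\<bar> < d \<Longrightarrow> c \<in> {lower N a..upper N a} \<Longrightarrow> \<bar>U (t + c) - U (s + c)\<bar> \<le> e / 2" by blast
  have "dist (arc_loss a U t) (arc_loss a U s) < e" if "dist t s < d" for t
  proof -
    have diff: "\<bar>U (t + c) - U (s + c)\<bar> \<le> e / 2" if "c \<in> {lower N a..upper N a}" for c
      using d(2) that \<open>dist t s < d\<close> by (simp add: dist_real_def)
    then have close: "U (t + c) \<le> U (s + c) + e / 2" "U (s + c) \<le> U (t + c) + e / 2"
      if "c \<in> {lower N a..upper N a}" for c using diff[OF that] unfolding abs_le_iff by auto
    note arc_loss_shift_le[OF close(1)] arc_loss_shift_le[OF close(2)]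
    with \<open>e > 0\<close> show ?thesis unfolding dist_real_def by linarith
  qed
  with d(1) show "\<exists>d>0. \<forall>t\<in>UNIV. dist t s < d \<longrightarrow> dist (arc_loss a U t) (arc_loss a U s) < e"
    by blast
qed

lemma arc_loss_ge:
  assumes "mono l" "continuous_on UNIV l" "\<And>s. l s \<le> U s"
  shows "l s \<le> arc_loss a U s"
proof -
  obtain p where p: "p \<in> ambiguity N a" using ambiguity_nonempty[OF a] by auto
  have "(\<integral>c. l s \<partial>p) \<le> (\<integral>c. U (s + c) \<partial>p)"
    using arc_lower_pos[OF a]
    by (intro integral_mono_arc[OF a p] continuous_shift order_trans[OF monoD[OF assms(1)] assms(3)]) auto
  with integral_le_arc_loss[OF p, of s] show ?thesis unfolding integral_const_arc[OF a p] by simp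
qed

text \<open>Inserting the expansion of \<open>U\<close> at shift \<open>y + c\<close> and
  integrating over \<open>c\<close>, the distribution enters only through its mean, linearly with
  the positive factor \<open>F s\<close>. The supremum over the ambiguity set thus turns the mean
  into the worst mean. The window is enlarged by \<open>upper N a\<close> so that it contains all
  shifts \<open>y + c\<close>.\<close>

lemma first_order_arc_loss:
  assumes fo: "first_order l F U M" and F: "\<forall>\<^sub>F s in at_top. F s > 0"
  shows "first_order l F (arc_loss a U) (worst_mean N a + M)"
  unfolding first_order_def
proof (intro allI impI)
  fix C e :: real assume Ce: "C > 0" "e > 0"
  have up: "upper N a > 0" using arc_lower_pos[OF a] arc_lower_le_upper[OF a] by linarith
  from first_orderD[OF fo, of "C + upper N a" e] Ce up F
  have "\<forall>\<^sub>F s in at_top. (\<forall>y\<in>{0..C + upper N a}. \<bar>U (s + y) - l s - (M + y) * F s\<bar> \<le> e * F s) \<and> F s > 0"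
    by (intro eventually_conj) auto
  then show "\<forall>\<^sub>F s in at_top. \<forall>y\<in>{0..C}.
    \<bar>arc_loss a U (s + y) - l s - (worst_mean N a + M + y) * F s\<bar> \<le> e * F s"
  proof eventually_elim
    case (elim s)
    show ?case
    proof
      fix y assume y: "y \<in> {0..C}"
      define B where "B = l s + (M + y) * F s"
      have U_le: "\<bar>U (s + y + c) - (B + c * F s)\<bar> \<le> e * F s" if "c \<in> {lower N a..upper N a}" for c
        using elim y that arc_lower_pos[OF a] bspec[OF conjunct1[OF elim], of "y + c"]
        by (simp add: B_def algebra_simps)
      have int: "(\<integral>c. U (s + y + c) \<partial>p) \<le> B + (\<integral>c. c \<partial>p) * F s + e * F s"
        "B + (\<integral>c. c \<partial>p) * F s \<le> (\<integral>c. U (s + y + c) \<partial>p) + e * F s" if p: "p \<in> ambiguity N a" for p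
      proof -
        interpret prob_space p by (rule ambiguity_arc[OF a p])
        have [simp]: "integrable p (\<lambda>c. c)" "integrable p (\<lambda>c. U (s + y + c))"
          using integrable_continuous[OF a p continuous_on_id] integrable_continuous[OF a p continuous_shift]
          by auto
        have "(\<integral>c. U (s + y + c) \<partial>p) \<le> (\<integral>c. (B + e * F s) + c * F s \<partial>p)"
          using U_le by (intro integral_mono_arc[OF a p] continuous_shift continuous_intros)
            (fastforce simp: abs_le_iff)
        also have "\<dots> = B + (\<integral>c. c \<partial>p) * F s + e * F s" by (simp add: prob_space)
        finally show "(\<integral>c. U (s + y + c) \<partial>p) \<le> B + (\<integral>c. c \<partial>p) * F s + e * F s" .
        have "B + (\<integral>c. c \<partial>p) * F s = (\<integral>c. B + c * F s \<partial>p)" by (simp add: prob_space)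
        also have "\<dots> \<le> (\<integral>c. U (s + y + c) + e * F s \<partial>p)"
          using U_le by (intro integral_mono_arc[OF a p] continuous_on_add continuous_shift continuous_intros)
            (fastforce simp: abs_le_iff)
        also have "\<dots> = (\<integral>c. U (s + y + c) \<partial>p) + e * F s" by (simp add: prob_space)
        finally show "B + (\<integral>c. c \<partial>p) * F s \<le> (\<integral>c. U (s + y + c) \<partial>p) + e * F s" .
      qed
      have "arc_loss a U (s + y) \<le> B + worst_mean N a * F s + e * F s"
      proof (rule arc_loss_le)
        fix p assume p: "p \<in> ambiguity N a"
        have "(\<integral>c. c \<partial>p) * F s \<le> worst_mean N a * F s"
          using mean_le_worst_mean[OF a p] elim by (intro mult_right_mono) auto
        with int(1)[OF p] show "(\<integral>c. U (s + y + c) \<partial>p) \<le> B + worst_mean N a * F s + e * F s" by linarith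
      qed
      \<comment> \<open>Dividing by \<open>F s > 0\<close> isolates the mean, so that the supremum
        over all distributions can be taken.\<close>
      moreover have "worst_mean N a \<le> (arc_loss a U (s + y) + e * F s - B) / F s"
      proof (rule worst_mean_le[OF a])
        fix p assume p: "p \<in> ambiguity N a"
        show "(\<integral>c. c \<partial>p) \<le> (arc_loss a U (s + y) + e * F s - B) / F s"
          using int(2)[OF p] integral_le_arc_loss[OF p, of "s + y"] elim by (simp add: le_divide_eq)
      qed
      then have "worst_mean N a * F s \<le> arc_loss a U (s + y) + e * F s - B"
        using elim by (simp add: le_divide_eq)
      ultimately show "\<bar>arc_loss a U (s + y) - l s - (worst_mean N a + M + y) * F s\<bar> \<le> e * F s"
        unfolding B_def by (simp add: abs_le_iff algebra_simps)
    qed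
  qed
qed

text \<open>By equicontinuity, a countable family of measures (nearly worst at rational points) contains a
  nearly worst one for every \<open>s\<close>; taking the first suitable index makes the choice measurable.\<close>

lemma measurable_near_worst:
  fixes e :: "real \<Rightarrow> real"
  assumes [measurable]: "e \<in> borel_measurable borel" and e: "\<And>s. e s > 0"
  obtains q where "q \<in> borel \<rightarrow>\<^sub>M prob_algebra borel" "\<And>s. q s \<in> ambiguity N a"
    "\<And>s. arc_loss a U s - e s \<le> (\<integral>c. U (s + c) \<partial>(q s))"
proof -
  have "\<exists>p\<in>ambiguity N a. arc_loss a U r - 1 / real (Suc n) \<le> (\<integral>c. U (r + c) \<partial>p)" for r n
  proof (rule ccontr)
    assume "\<not> ?thesis"
    then have "arc_loss a U r \<le> arc_loss a U r - 1 / real (Suc n)"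
      by (intro arc_loss_le) force
    then show False by simp
  qed
  then obtain p where p: "\<And>r n. p r n \<in> ambiguity N a"
    "\<And>r n. arc_loss a U r - 1 / real (Suc n) \<le> (\<integral>c. U (r + c) \<partial>(p r n))" by metis
  define P where "P m = (case from_nat m of (r, n) \<Rightarrow> p (real_of_rat r) n)" for m
  have P: "P m \<in> ambiguity N a" for m by (auto simp: P_def p split: prod.split)
  define good where "good s m \<longleftrightarrow> arc_loss a U s - e s \<le> (\<integral>c. U (s + c) \<partial>(P m))" for s m
  have ex: "\<exists>m. good s m" for s
  proof -
    \<comment> \<open>Three errors arise: moving the supremum from \<open>s\<close> to the rational
      point, the choice at that point, and moving the integral back to \<open>s\<close>.\<close>
    obtain n where n: "1 / real (Suc n) < e s / 3" using e[of s] by (metis nat_approx_posE zero_less_divide_iff zero_less_numeral)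
    from continuous_on_uniform_shift[OF U, of "1 / real (Suc n)" s "lower N a" "upper N a"] obtain d where d: "d > 0"
      "\<And>t c. \<bar>t - s\<bar> < d \<Longrightarrow> c \<in> {lower N a..upper N a} \<Longrightarrow> \<bar>U (t + c) - U (s + c)\<bar> \<le> 1 / real (Suc n)" by auto
    obtain r where r: "s < real_of_rat r" "real_of_rat r < s + d" using of_rat_dense[of s "s + d"] d by auto
    then have close: "\<bar>U (real_of_rat r + c) - U (s + c)\<bar> \<le> 1 / real (Suc n)"
      if "c \<in> {lower N a..upper N a}" for c using d(2) that by simp
    have "arc_loss a U s \<le> arc_loss a U (real_of_rat r) + 1 / real (Suc n)"
      by (intro arc_loss_shift_le) (use close in \<open>fastforce simp: abs_le_iff\<close>)
    moreover have "(\<integral>c. U (real_of_rat r + c) \<partial>(p (real_of_rat r) n)) \<le>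
        (\<integral>c. U (s + c) \<partial>(p (real_of_rat r) n)) + 1 / real (Suc n)"
      by (intro integral_shift_le p) (use close in \<open>fastforce simp: abs_le_iff\<close>)
    ultimately have "good s (to_nat (r, n))"
      using p(2)[of "real_of_rat r" n] n unfolding good_def by (simp add: P_def)
    then show ?thesis ..
  qed
  have [measurable]: "arc_loss a U \<in> borel_measurable borel"
    by (intro borel_measurable_continuous_onI continuous_on_arc_loss)
  have [measurable]: "(\<lambda>s. \<integral>c. U (s + c) \<partial>(P m)) \<in> borel_measurable borel" for m
    by (intro borel_measurable_continuous_onI continuous_on_integral_shift P)
  have idx: "(\<lambda>s. LEAST m. good s m) \<in> borel \<rightarrow>\<^sub>M count_space UNIV"
    unfolding good_def by measurable
  have "P \<in> count_space UNIV \<rightarrow>\<^sub>M prob_algebra borel"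
    using ambiguity_arc(3,4)[OF a P] by (auto simp: space_prob_algebra)
  from measurable_compose[OF idx this] show thesis
    using P LeastI_ex[OF ex] by (intro that) (auto simp: good_def)
qed

end

end

text \<open>The argument of \<open>l\<close> is the excess \<open>spent h - T\<close>; for large \<open>s\<close>, \<open>l s\<close> stands for \<open>- f (- s)\<close>.\<close>

locale tail_loss = robust_routing N for N :: "'v network" +
  fixes l F :: "real \<Rightarrow> real"
  assumes loss_continuous: "continuous_on UNIV l" and loss_mono: "mono l" and loss_ge_1: "\<And>s. 1 \<le> l s"
    and loss_at_top: "filterlim l at_top at_top"
    and slope_pos: "\<forall>\<^sub>F s in at_top. F s > 0" and loss_first_order: "first_order l F l 0"
begin

text \<open>Outside of the vertex set the value is that of the destination. The node type may be
  uncountable, and with this default measurability in the current node concerns finitely many values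
  only.\<close>

definition node_loss :: "'v \<Rightarrow> real \<Rightarrow> real" where
  "node_loss = wfrec tree_rel (\<lambda>U i. if i = dest N \<or> i \<notin> pverts (graph N) then l
     else (\<lambda>s. MIN j\<in>tree_successors N i. arc_loss (i, j) (U j) s))"

lemma node_loss_terminal: "i = dest N \<or> i \<notin> pverts (graph N) \<Longrightarrow> node_loss i = l"
  unfolding node_loss_def by (subst wfrec[OF wf_tree_rel]) simp

lemma node_loss_rec:
  assumes "i \<in> pverts (graph N)" "i \<noteq> dest N"
  shows "node_loss i = (\<lambda>s. MIN j\<in>tree_successors N i. arc_loss (i, j) (node_loss j) s)"
proof -
  have "cut node_loss tree_rel i j = node_loss j" if "j \<in> tree_successors N i" for j
    using that by (simp add: cut_def tree_rel_def)
  then show ?thesis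
    using assms unfolding node_loss_def by (subst wfrec[OF wf_tree_rel]) (simp cong: image_cong)
qed

text \<open>The properties go through the induction together, since the facts about
  \<open>arc_loss\<close> need continuity of the successor's loss. All tree arcs out of
  \<open>i\<close> give the same coefficient
  \<open>worst_mean N (i, j) + dist_to j = dist_to i\<close>, so the minimum inherits it.\<close>

lemma node_loss_props:
  "continuous_on UNIV (node_loss i) \<and> (\<forall>s. l s \<le> node_loss i s) \<and>
    (i \<in> pverts (graph N) \<longrightarrow> first_order l F (node_loss i) (dist_to i))"
  using wf_tree_rel
proof (induction i rule: wf_induct_rule)
  case (less i)
  show ?case
  proof (cases "i = dest N \<or> i \<notin> pverts (graph N)")
    case True
    then show ?thesis
      using loss_continuous loss_first_order by (auto simp: node_loss_terminal dist_to_dest)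
  next
    case False
    then have i: "i \<in> pverts (graph N)" "i \<noteq> dest N" by auto
    let ?T = "tree_successors N i"
    note T = finite_tree_successors[of i] tree_successors_nonempty[OF i]
    have IH: "continuous_on UNIV (node_loss j)" "\<And>s. l s \<le> node_loss j s"
      "first_order l F (node_loss j) (dist_to j)" "(i, j) \<in> parcs (graph N)" if "j \<in> ?T" for j
      using less.IH[of j] that tree_successors_arc[OF that] arc_verts by (auto simp: tree_rel_def)
    have "continuous_on UNIV (node_loss i)"
      unfolding node_loss_rec[OF i] using IH by (intro continuous_on_Min_image T continuous_on_arc_loss)
    moreover have "l s \<le> node_loss i s" for s
      unfolding node_loss_rec[OF i] using T IH
      by (auto simp: Min_ge_iff intro!: arc_loss_ge loss_mono loss_continuous)
    moreover have "first_order l F (node_loss i) (dist_to i)"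
      unfolding node_loss_rec[OF i]
    proof (intro first_order_Min_image T)
      fix j assume j: "j \<in> ?T"
      with tree_successors_iff[OF IH(4)[OF j]]
      show "first_order l F (arc_loss (i, j) (node_loss j)) (dist_to i)"
        using first_order_arc_loss[OF IH(4,1,3)[OF j] slope_pos] by simp
    qed
    ultimately show ?thesis by blast
  qed
qed

lemma continuous_node_loss: "continuous_on UNIV (node_loss i)"
  and loss_le_node_loss: "l s \<le> node_loss i s"
  and first_order_node_loss: "i \<in> pverts (graph N) \<Longrightarrow> first_order l F (node_loss i) (dist_to i)"
  using node_loss_props by auto

lemma node_loss_tree_le:
  assumes "i \<in> pverts (graph N)" "i \<noteq> dest N" "j \<in> tree_successors N i"
  shows "node_loss i s \<le> arc_loss (i, j) (node_loss j) s"
  unfolding node_loss_rec[OF assms(1,2)] using assms finite_tree_successors by (auto intro!: Min_le)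

lemma node_loss_attained:
  assumes "i \<in> pverts (graph N)" "i \<noteq> dest N"
  shows "\<exists>j\<in>tree_successors N i. node_loss i s = arc_loss (i, j) (node_loss j) s"
proof -
  have "node_loss i s \<in> (\<lambda>j. arc_loss (i, j) (node_loss j) s) ` tree_successors N i"
    unfolding node_loss_rec[OF assms]
    using finite_tree_successors tree_successors_nonempty[OF assms] by (intro Min_in) auto
  then show ?thesis by auto
qed

text \<open>An arc off the tree has a coefficient strictly above \<open>dist_to i\<close>, and there
  are finitely many arcs. Above the resulting threshold the recursion over tree arcs is thus a
  dynamic programming inequality for all arcs.\<close>

lemma eventually_off_tree:
  "\<forall>\<^sub>F s in at_top. \<forall>(i, j)\<in>parcs (graph N). i \<noteq> dest N \<longrightarrow> j \<notin> tree_successors N i \<longrightarrow>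
     node_loss i s < arc_loss (i, j) (node_loss j) s"
proof (intro eventually_ball_finite finite_arcs ballI, clarify)
  fix i j assume a: "(i, j) \<in> parcs (graph N)"
  have "\<forall>\<^sub>F s in at_top. node_loss i s < arc_loss (i, j) (node_loss j) s" if "j \<notin> tree_successors N i"
    using that arc_verts[OF a] dist_to_arc_le[OF a] tree_successors_iff[OF a]
    by (intro first_order_less[OF first_order_node_loss first_order_arc_loss[OF a continuous_node_loss first_order_node_loss slope_pos]] slope_pos) auto
  then show "\<forall>\<^sub>F s in at_top. i \<noteq> dest N \<longrightarrow> j \<notin> tree_successors N i \<longrightarrow>
      node_loss i s < arc_loss (i, j) (node_loss j) s"
    by (cases "j \<in> tree_successors N i") (auto elim: eventually_mono)
qed

lemma eventually_node_loss_le: "\<exists>K. \<forall>\<^sub>F s in at_top. \<forall>i. node_loss i s \<le> K * l s"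
proof -
  have l0: "0 \<le> l s" for s using loss_ge_1[of s] by linarith
  have "\<exists>K. \<forall>\<^sub>F s in at_top. node_loss i s \<le> K * l s" if "i \<in> pverts (graph N)" for i
    by (rule first_order_bigo[OF loss_first_order loss_mono l0 slope_pos first_order_node_loss[OF that]])
  then obtain K where K: "\<And>i. i \<in> pverts (graph N) \<Longrightarrow> \<forall>\<^sub>F s in at_top. node_loss i s \<le> K i * l s"
    by metis
  \<comment> \<open>The 1 covers the nodes outside of the graph, whose loss is
    \<open>l\<close>.\<close>
  define K' where "K' = 1 + (\<Sum>i\<in>pverts (graph N). \<bar>K i\<bar>)"
  have "\<forall>\<^sub>F s in at_top. \<forall>i\<in>pverts (graph N). node_loss i s \<le> K i * l s"
    using K by (intro eventually_ball_finite finite_verts) auto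
  then have "\<forall>\<^sub>F s in at_top. \<forall>i. node_loss i s \<le> K' * l s"
  proof eventually_elim
    case (elim s)
    show ?case
    proof
      fix i
      show "node_loss i s \<le> K' * l s"
      proof (cases "i \<in> pverts (graph N)")
        case True
        have "K i \<le> K'"
          using member_le_sum[of i "pverts (graph N)" "\<lambda>i. \<bar>K i\<bar>"] True finite_verts unfolding K'_def by simp
        then have "K i * l s \<le> K' * l s" using l0 by (intro mult_right_mono)
        with elim True show ?thesis by force
      next
        case False
        have "1 * l s \<le> K' * l s" unfolding K'_def using l0 by (intro mult_right_mono) (auto intro: sum_nonneg)
        with False show ?thesis by (simp add: node_loss_terminal)
      qed
    qed
  qed
  then show ?thesis ..
qed

end

section \<open>The law of a trajectory\<close>

lemma current_simps [simp]: "current N [] = source N" "current N (h @ [x]) = fst x"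
  "current N (h @ h' @ [x]) = fst x"
  by (simp_all add: current_def)

lemma current_append_map_Suc: "current N (h @ map \<omega> [0..<Suc n]) = fst (\<omega> n)"
  by (simp add: current_def)

lemma spent_append [simp]: "spent (h @ h') = spent h + spent h'"
  by (simp add: spent_def)

lemma spent_singleton [simp]: "spent [x] = snd x"
  by (simp add: spent_def)

lemma spent_map_upt: "spent (map \<omega> [0..<n]) = (\<Sum>i<n. snd (\<omega> i))"
  by (induction n) (auto simp: spent_def)

lemma histories_snoc_iff:
  "h @ [x] \<in> histories N \<longleftrightarrow> h \<in> histories N \<and> current N h \<noteq> dest N \<and>
     (current N h, fst x) \<in> parcs (graph N) \<and>
     snd x \<in> {lower N (current N h, fst x)..upper N (current N h, fst x)}"
  (is "_ \<longleftrightarrow> ?R")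
proof
  assume "h @ [x] \<in> histories N"
  then show ?R by cases auto
next
  assume ?R
  then show "h @ [x] \<in> histories N"
    using histories.move[of h N "fst x" "snd x"] by simp
qed

context robust_routing begin

lemma current_in_verts: "h \<in> histories N \<Longrightarrow> current N h \<in> pverts (graph N)"
  by (induction rule: histories.induct) (auto simp: source_in dest: arc_verts)

lemma spent_nonneg: "h \<in> histories N \<Longrightarrow> 0 \<le> spent h"
proof (induction rule: histories.induct)
  case (move h j c)
  then show ?case using arc_lower_pos[of "(current N h, j)"] by auto
qed (simp add: spent_def)

text \<open>Over an uncountable node type, measurability of each \<open>f i\<close> would not
  suffice. Retracting all other nodes to \<open>dest N\<close> leaves a finite index set.\<close>

lemma measurable_compose_node:
  assumes "g \<in> M \<rightarrow>\<^sub>M count_space UNIV" "\<And>i. i \<in> pverts (graph N) \<Longrightarrow> f i \<in> M \<rightarrow>\<^sub>M L"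
    "\<And>i. i \<notin> pverts (graph N) \<Longrightarrow> f i = f (dest N)"
  shows "(\<lambda>x. f (g x) x) \<in> M \<rightarrow>\<^sub>M L"
proof -
  define t where "t i = (if i \<in> pverts (graph N) then i else dest N)" for i
  have "t \<in> count_space UNIV \<rightarrow>\<^sub>M count_space (pverts (graph N))" by (auto simp: t_def dest_in)
  note tg = measurable_compose[OF assms(1) this]
  have "(\<lambda>x. f (t (g x)) x) \<in> M \<rightarrow>\<^sub>M L"
    by (rule measurable_compose_countable'[OF assms(2) tg]) (auto intro: countable_finite)
  moreover have "f (t i) = f i" for i using assms(3) by (auto simp: t_def)
  ultimately show ?thesis by simp
qed

text \<open>The index set stays general: it is finite for the kernels and \<open>UNIV\<close> for
  the whole trajectory.\<close>

lemma measurable_current: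
  assumes "{0..<n} \<subseteq> I"
  shows "(\<lambda>\<omega>. current N (h @ map \<omega> [0..<n])) \<in> PiM I (\<lambda>_. move_space) \<rightarrow>\<^sub>M count_space UNIV"
proof (cases n)
  case (Suc m)
  then have [measurable]: "m \<in> I" using assms by auto
  show ?thesis unfolding Suc current_append_map_Suc by measurable
qed simp

lemma measurable_spent:
  assumes "{0..<n} \<subseteq> I"
  shows "(\<lambda>\<omega>. spent (h @ map \<omega> [0..<n])) \<in> borel_measurable (PiM I (\<lambda>_. move_space))"
proof -
  have [measurable]: "(\<lambda>\<omega>. snd (\<omega> i)) \<in> borel_measurable (PiM I (\<lambda>_. move_space))" if "i < n" for i
  proof -
    have [measurable]: "i \<in> I" using that assms by auto
    show ?thesis by measurable
  qed
  show ?thesis unfolding spent_append spent_map_upt by measurable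
qed

text \<open>Finiteness of the arc set writes the condition as a finite union of rectangles with
  constant cost bounds. Over an uncountable node type, relations between two nodes need not be
  measurable in the product.\<close>

lemma measurable_move_ok [measurable]:
  "Measurable.pred (count_space UNIV \<Otimes>\<^sub>M move_space) (\<lambda>(i, x). (i, fst x) \<in> parcs (graph N) \<and>
     snd x \<in> {lower N (i, fst x)..upper N (i, fst x)})"
proof -
  have "Measurable.pred (count_space UNIV \<Otimes>\<^sub>M move_space) (\<lambda>z. \<exists>a\<in>parcs (graph N). fst z = fst a \<and>
     fst (snd z) = snd a \<and> lower N a \<le> snd (snd z) \<and> snd (snd z) \<le> upper N a)"
    using finite_arcs by (intro pred_intros_finite) measurable
  also have "(\<lambda>z. \<exists>a\<in>parcs (graph N). fst z = fst a \<and> fst (snd z) = snd a \<and>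
      lower N a \<le> snd (snd z) \<and> snd (snd z) \<le> upper N a) =
    (\<lambda>(i, x). (i, fst x) \<in> parcs (graph N) \<and> snd x \<in> {lower N (i, fst x)..upper N (i, fst x)})"
    by (force simp: fun_eq_iff)
  finally show ?thesis .
qed

lemma measurable_histories:
  assumes "{0..<n} \<subseteq> I"
  shows "Measurable.pred (PiM I (\<lambda>_. move_space)) (\<lambda>\<omega>. h @ map \<omega> [0..<n] \<in> histories N)"
  using assms
proof (induction n)
  case (Suc n)
  then have n: "{0..<n} \<subseteq> I" and [measurable]: "n \<in> I" by auto
  have [measurable]: "Measurable.pred (PiM I (\<lambda>_. move_space)) (\<lambda>\<omega>. h @ map \<omega> [0..<n] \<in> histories N)"
    using Suc.IH n .
  note [measurable] = measurable_current[OF n, of h]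
  have "Measurable.pred (PiM I (\<lambda>_. move_space)) (\<lambda>\<omega>. (\<lambda>(i, x). (i, fst x) \<in> parcs (graph N) \<and>
     snd x \<in> {lower N (i, fst x)..upper N (i, fst x)}) (current N (h @ map \<omega> [0..<n]), \<omega> n))"
    by measurable
  then have [measurable]: "Measurable.pred (PiM I (\<lambda>_. move_space))
    (\<lambda>\<omega>. (current N (h @ map \<omega> [0..<n]), fst (\<omega> n)) \<in> parcs (graph N) \<and>
      snd (\<omega> n) \<in> {lower N (current N (h @ map \<omega> [0..<n]), fst (\<omega> n))..
        upper N (current N (h @ map \<omega> [0..<n]), fst (\<omega> n))})"
    by simp
  have "Measurable.pred (PiM I (\<lambda>_. move_space)) (\<lambda>\<omega>. h @ map \<omega> [0..<n] \<in> histories N \<and>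
      current N (h @ map \<omega> [0..<n]) \<noteq> dest N \<and>
      (current N (h @ map \<omega> [0..<n]), fst (\<omega> n)) \<in> parcs (graph N) \<and>
      snd (\<omega> n) \<in> {lower N (current N (h @ map \<omega> [0..<n]), fst (\<omega> n))..
        upper N (current N (h @ map \<omega> [0..<n]), fst (\<omega> n))})"
    by measurable
  then show ?case
    unfolding histories_snoc_iff[symmetric] by simp
qed simp

end

section \<open>The transition kernel of a run and the construction of its law\<close>

locale routing_run = robust_routing N for N :: "'v network" +
  fixes p :: "real \<Rightarrow> 'v \<times> 'v \<Rightarrow> real measure" and \<pi> :: "'v history \<Rightarrow> 'v pmf" and h :: "'v history"
  assumes cost_family: "p \<in> cost_families N" and strategy: "\<pi> \<in> strategies N" and history: "h \<in> histories N"
begin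

lemma p_ambiguity: "\<tau> \<ge> 0 \<Longrightarrow> a \<in> parcs (graph N) \<Longrightarrow> p \<tau> a \<in> ambiguity N a"
  using cost_family by (auto simp: cost_families_def)

lemma \<pi>_successors: "h' \<in> histories N \<Longrightarrow> current N h' \<noteq> dest N \<Longrightarrow> set_pmf (\<pi> h') \<subseteq> successors N (current N h')"
  using strategy by (auto simp: strategies_def)

abbreviation "dummy \<equiv> return move_space (dest N, 0 :: real)"

lemma next_move_dummy:
  "h' \<notin> histories N \<or> current N h' = dest N \<Longrightarrow> next_move N p \<pi> h' = dummy"
  by (auto simp: next_move_def)

context
  fixes h' assumes h': "h' \<in> histories N" "current N h' \<noteq> dest N"
begin

definition "move_from j = (if (current N h', j) \<in> parcs (graph N)
  then distr (p (spent h') (current N h', j)) move_space (Pair j) else dummy)"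

lemma next_move_bind: "next_move N p \<pi> h' = measure_pmf (\<pi> h') \<bind> move_from"
  using h' unfolding next_move_def Let_def move_from_def[abs_def] by simp

lemma measurable_Pair_arc:
  assumes "(current N h', j) \<in> parcs (graph N)"
  shows "Pair j \<in> p (spent h') (current N h', j) \<rightarrow>\<^sub>M move_space"
  unfolding measurable_cong_sets[OF ambiguity_arc(4)[OF assms p_ambiguity[OF spent_nonneg[OF h'(1)] assms]] refl]
  by measurable

lemma move_from: "prob_space (move_from j)" "sets (move_from j) = sets move_space"
proof -
  show "prob_space (move_from j)"
  proof (cases "(current N h', j) \<in> parcs (graph N)")
    case True
    interpret prob_space "p (spent h') (current N h', j)"
      by (rule ambiguity_arc(3)[OF True p_ambiguity[OF spent_nonneg[OF h'(1)] True]])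
    show ?thesis using True measurable_Pair_arc[OF True] by (simp add: move_from_def prob_space_distr)
  next
    case False
    then show ?thesis by (simp add: move_from_def) (rule prob_space_return, simp add: space_pair_measure)
  qed
  show "sets (move_from j) = sets move_space" by (simp add: move_from_def)
qed

lemma measurable_move_from: "move_from \<in> measure_pmf q \<rightarrow>\<^sub>M subprob_algebra move_space"
  using move_from by (auto simp: measurable_def space_subprob_algebra prob_space_imp_subprob_space)

lemma nn_integral_next_move:
  assumes [measurable]: "g \<in> borel_measurable move_space"
  shows "(\<integral>\<^sup>+x. g x \<partial>next_move N p \<pi> h') = (\<Sum>j\<in>successors N (current N h').
    ennreal (pmf (\<pi> h') j) * (\<integral>\<^sup>+c. g (j, c) \<partial>p (spent h') (current N h', j)))"
proof -
  have "(\<integral>\<^sup>+x. g x \<partial>next_move N p \<pi> h') = (\<integral>\<^sup>+j. \<integral>\<^sup>+x. g x \<partial>move_from j \<partial>measure_pmf (\<pi> h'))"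
    unfolding next_move_bind by (rule nn_integral_bind[OF assms measurable_move_from])
  also have "\<dots> = (\<Sum>j\<in>successors N (current N h'). (\<integral>\<^sup>+x. g x \<partial>move_from j) * ennreal (pmf (\<pi> h') j))"
    by (rule nn_integral_measure_pmf_support[OF finite_successors])
      (use \<pi>_successors[OF h'] in auto)
  also have "\<dots> = (\<Sum>j\<in>successors N (current N h').
    ennreal (pmf (\<pi> h') j) * (\<integral>\<^sup>+c. g (j, c) \<partial>p (spent h') (current N h', j)))"
  proof (rule sum.cong[OF refl])
    fix j assume "j \<in> successors N (current N h')"
    then have j: "(current N h', j) \<in> parcs (graph N)" by simp
    show "(\<integral>\<^sup>+x. g x \<partial>move_from j) * ennreal (pmf (\<pi> h') j) =
      ennreal (pmf (\<pi> h') j) * (\<integral>\<^sup>+c. g (j, c) \<partial>p (spent h') (current N h', j))"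
      using j by (simp add: move_from_def nn_integral_distr[OF measurable_Pair_arc[OF j]] mult.commute)
  qed
  finally show ?thesis .
qed

end

lemma next_move_props: "prob_space (next_move N p \<pi> h')" "sets (next_move N p \<pi> h') = sets move_space"
proof -
  show "prob_space (next_move N p \<pi> h')"
  proof (cases "h' \<in> histories N \<and> current N h' \<noteq> dest N")
    case True
    then have h': "h' \<in> histories N" "current N h' \<noteq> dest N" by auto
    show ?thesis unfolding next_move_bind[OF h']
      by (rule prob_space.prob_space_bind[OF _ _ measurable_move_from[OF h']])
        (auto simp: move_from[OF h'] measure_pmf.prob_space_axioms)
  next
    case False
    then show ?thesis
      by (subst next_move_dummy) (auto intro!: prob_space_return simp: space_pair_measure)
  qed
  show "sets (next_move N p \<pi> h') = sets move_space"
  proof (cases "h' \<in> histories N \<and> current N h' \<noteq> dest N")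
    case True
    then have h': "h' \<in> histories N" "current N h' \<noteq> dest N" by auto
    show ?thesis unfolding next_move_bind[OF h']
      by (rule sets_bind) (auto simp: move_from[OF h'])
  next
    case False
    then show ?thesis by (subst next_move_dummy) auto
  qed
qed

text \<open>Strategies are measurable in all moves since the source, whereas a run starts after the
  fixed history \<open>h\<close>. The map \<open>\<Theta>\<close> puts \<open>h\<close> in front of
  the new moves.\<close>

lemma measurable_strategy:
  "(\<lambda>\<omega>. pmf (\<pi> (h @ map \<omega> [0..<n])) j) \<in> borel_measurable (restrict_space (PiM {0..<n} (\<lambda>_. move_space))
     {\<omega>. h @ map \<omega> [0..<n] \<in> histories N \<and> current N (h @ map \<omega> [0..<n]) \<noteq> dest N})"
proof -
  define m where "m = length h + n"
  define \<Theta> where "\<Theta> \<omega> = (\<lambda>k\<in>{0..<m}. if k < length h then h ! k else \<omega> (k - length h))" for \<omega>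
  have map: "map (\<Theta> \<omega>) [0..<m] = h @ map \<omega> [0..<n]" for \<omega>
    by (rule nth_equalityI) (auto simp: \<Theta>_def m_def nth_append)
  have "\<Theta> \<in> PiM {0..<n} (\<lambda>_. move_space) \<rightarrow>\<^sub>M PiM {0..<m} (\<lambda>_. move_space)"
    unfolding \<Theta>_def[abs_def]
  proof (rule measurable_restrict)
    fix k assume k: "k \<in> {0..<m}"
    show "(\<lambda>\<omega>. if k < length h then h ! k else \<omega> (k - length h)) \<in> PiM {0..<n} (\<lambda>_. move_space) \<rightarrow>\<^sub>M move_space"
      using k by (cases "k < length h")
        (auto simp: m_def space_pair_measure intro!: measurable_component_singleton)
  qed
  then have \<Theta>: "\<Theta> \<in> restrict_space (PiM {0..<n} (\<lambda>_. move_space))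
       {\<omega>. h @ map \<omega> [0..<n] \<in> histories N \<and> current N (h @ map \<omega> [0..<n]) \<noteq> dest N} \<rightarrow>\<^sub>M
     restrict_space (PiM {0..<m} (\<lambda>_. move_space))
       {\<omega>. map \<omega> [0..<m] \<in> histories N \<and> current N (map \<omega> [0..<m]) \<noteq> dest N}"
    by (rule measurable_restrict_space3) (auto simp: map)
  have "(\<lambda>\<omega>. pmf (\<pi> (map \<omega> [0..<m])) j) \<in> borel_measurable (restrict_space (PiM {0..<m} (\<lambda>_. move_space))
       {\<omega>. map \<omega> [0..<m] \<in> histories N \<and> current N (map \<omega> [0..<m]) \<noteq> dest N})"
    using strategy by (simp add: strategies_def)
  from measurable_compose[OF \<Theta> this] show ?thesis by (simp add: map)
qed

lemma measurable_next_move: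
  "(\<lambda>\<omega>. next_move N p \<pi> (h @ map \<omega> [0..<n])) \<in> PiM {0..<n} (\<lambda>_. move_space) \<rightarrow>\<^sub>M subprob_algebra move_space"
proof (rule measurable_subprob_algebra)
  fix A :: "('v \<times> real) set" assume A: "A \<in> sets move_space"
  let ?M = "PiM {0..<n} (\<lambda>_. move_space) :: (nat \<Rightarrow> 'v \<times> real) measure"
  let ?h = "\<lambda>\<omega>. h @ map \<omega> [0..<n]"
  \<comment> \<open>The strategy is measurable on this event only, and on it the spent cost is
    nonnegative, as the cost family requires. Elsewhere the kernel is the constant dummy
    move.\<close>
  define E where "E = {\<omega>. ?h \<omega> \<in> histories N \<and> current N (?h \<omega>) \<noteq> dest N}"
  note [measurable] = measurable_current[OF subset_refl, of h n] measurable_histories[OF subset_refl, of h n]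
  have E: "{\<omega> \<in> space ?M. \<omega> \<in> E} \<in> sets ?M" unfolding E_def mem_Collect_eq by measurable
  have "(\<lambda>\<omega>. if \<omega> \<in> E then emeasure (next_move N p \<pi> (?h \<omega>)) A else indicator A (dest N, 0)) \<in> borel_measurable ?M"
  proof (subst measurable_If_restrict_space_iff[OF E], intro conjI)
    define R where "R = restrict_space ?M {\<omega>. \<omega> \<in> E}"
    have RE: "\<omega> \<in> E" if "\<omega> \<in> space R" for \<omega> using that by (simp add: R_def space_restrict_space)
    \<comment> \<open>The node \<open>i\<close> is separated from \<open>\<omega>\<close>: for fixed
      \<open>i\<close> the sum is over a fixed finite set of arcs, and the current node has finitely
      many values.\<close>
    define V where "V i \<omega> = (\<Sum>j\<in>successors N i. ennreal (pmf (\<pi> (?h \<omega>)) j) *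
      emeasure (p (spent (?h \<omega>)) (i, j)) (Pair j -` A))" for i \<omega>
    have "(\<lambda>\<omega>. V (current N (?h \<omega>)) \<omega>) \<in> borel_measurable R"
    proof (rule measurable_compose_countable'[where I="pverts (graph N)"])
      show "(\<lambda>\<omega>. current N (?h \<omega>)) \<in> R \<rightarrow>\<^sub>M count_space (pverts (graph N))"
        unfolding measurable_count_space_eq2[OF finite_verts]
      proof (intro conjI ballI)
        show "(\<lambda>\<omega>. current N (?h \<omega>)) \<in> space R \<rightarrow> pverts (graph N)"
          using RE by (auto simp: E_def intro: current_in_verts)
        have "(\<lambda>\<omega>. current N (?h \<omega>)) \<in> R \<rightarrow>\<^sub>M count_space UNIV"
          unfolding R_def by (intro measurable_restrict_space1) measurable
        then show "(\<lambda>\<omega>. current N (?h \<omega>)) -` {a} \<inter> space R \<in> sets R" for a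
          by (rule measurable_sets) simp
      qed
      show "countable (pverts (graph N))" by (intro countable_finite) auto
      fix i
      show "V i \<in> borel_measurable R"
        unfolding V_def[abs_def]
      proof (intro borel_measurable_sum borel_measurable_times_ennreal)
        fix j assume "j \<in> successors N i"
        then have a: "(i, j) \<in> parcs (graph N)" by simp
        show "(\<lambda>\<omega>. ennreal (pmf (\<pi> (?h \<omega>)) j)) \<in> borel_measurable R"
          using measurable_strategy[of n j] unfolding R_def E_def by simp
        have "(\<lambda>\<omega>. spent (?h \<omega>)) \<in> R \<rightarrow>\<^sub>M restrict_space borel {0..}"
          unfolding R_def by (intro measurable_restrict_space3 measurable_spent subset_refl)
            (auto simp: E_def spent_nonneg simp del: spent_append)
        moreover have "(\<lambda>\<tau>. p \<tau> (i, j)) \<in> restrict_space borel {0..} \<rightarrow>\<^sub>M prob_algebra borel"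
          using cost_family a by (auto simp: cost_families_def)
        ultimately have "(\<lambda>\<omega>. p (spent (?h \<omega>)) (i, j)) \<in> R \<rightarrow>\<^sub>M prob_algebra borel"
          by (rule measurable_compose)
        from measurable_prob_algebraD[OF this]
        show "(\<lambda>\<omega>. emeasure (p (spent (?h \<omega>)) (i, j)) (Pair j -` A)) \<in> borel_measurable R"
          by (rule measurable_emeasure_kernel) (use sets_Pair1[OF A, of j] in simp)
      qed
    qed
    moreover have "emeasure (next_move N p \<pi> (?h \<omega>)) A = V (current N (?h \<omega>)) \<omega>" if "\<omega> \<in> space R" for \<omega>
    proof -
      have h': "?h \<omega> \<in> histories N" "current N (?h \<omega>) \<noteq> dest N" using RE[OF that] by (auto simp: E_def)
      have "emeasure (next_move N p \<pi> (?h \<omega>)) A = (\<integral>\<^sup>+x. indicator A x \<partial>next_move N p \<pi> (?h \<omega>))"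
        using A next_move_props(2) by simp
      also have "\<dots> = V (current N (?h \<omega>)) \<omega>"
        unfolding nn_integral_next_move[OF h' borel_measurable_indicator[OF A]] V_def
      proof (intro sum.cong refl arg_cong2[where f="(*)"])
        fix j assume "j \<in> successors N (current N (?h \<omega>))"
        then have a: "(current N (?h \<omega>), j) \<in> parcs (graph N)" by simp
        have "Pair j -` A \<in> sets (p (spent (?h \<omega>)) (current N (?h \<omega>), j))"
          using ambiguity_arc(4)[OF a p_ambiguity[OF spent_nonneg[OF h'(1)] a]] sets_Pair1[OF A, of j] by simp
        moreover have "indicator A (j, c) = (indicator (Pair j -` A) c :: ennreal)" for c
          by (simp add: indicator_def)
        ultimately show "(\<integral>\<^sup>+c. indicator A (j, c) \<partial>p (spent (?h \<omega>)) (current N (?h \<omega>), j)) =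
          emeasure (p (spent (?h \<omega>)) (current N (?h \<omega>), j)) (Pair j -` A)"
          by simp
      qed
      finally show ?thesis .
    qed
    ultimately show "(\<lambda>\<omega>. emeasure (next_move N p \<pi> (?h \<omega>)) A) \<in> borel_measurable (restrict_space ?M {\<omega>. \<omega> \<in> E})"
      unfolding R_def[symmetric] by (subst measurable_cong) auto
  qed simp
  also have "(\<lambda>\<omega>. if \<omega> \<in> E then emeasure (next_move N p \<pi> (?h \<omega>)) A else indicator A (dest N, 0)) =
    (\<lambda>\<omega>. emeasure (next_move N p \<pi> (?h \<omega>)) A)"
  proof
    fix \<omega>
    show "(if \<omega> \<in> E then emeasure (next_move N p \<pi> (?h \<omega>)) A else indicator A (dest N, 0)) =
      emeasure (next_move N p \<pi> (?h \<omega>)) A"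
      using A next_move_dummy[of "?h \<omega>"] by (auto simp: E_def)
  qed
  finally show "(\<lambda>\<omega>. emeasure (next_move N p \<pi> (?h \<omega>)) A) \<in> borel_measurable ?M" .
qed (use next_move_props prob_space_imp_subprob_space in auto)

sublocale IT: Ionescu_Tulcea "\<lambda>n \<omega>. next_move N p \<pi> (h @ map \<omega> [0..<n])" "\<lambda>_. move_space"
  by (rule Ionescu_Tulcea.intro) (rule measurable_next_move, rule next_move_props)

abbreviation "traj \<equiv> trajectory N p \<pi> h"

lemma trajectory_eq: "traj = IT.PF.lim"
  unfolding trajectory_def ..

lemma sets_traj [measurable_cong]: "sets traj = sets (PiM UNIV (\<lambda>_. move_space))"
  unfolding trajectory_eq by (rule IT.PF.sets_lim)

lemma up_to_Ico: "IT.up_to {0..<n} = n"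
proof (rule antisym)
  show "IT.up_to {0..<n} \<le> n" by (simp add: IT.up_to_iff)
  show "n \<le> IT.up_to {0..<n}" using IT.up_to_less[of "{0..<n}" "n - 1"] by (cases n) auto
qed

text \<open>A function of the first \<open>n\<close> moves is integrated by the finite composition
  of kernels. Its start \<open>\<lambda>_. undefined\<close> is the only point of the product over
  the empty index set.\<close>

lemma nn_integral_traj:
  assumes f: "f \<in> borel_measurable (PiM {0..<n} (\<lambda>_. move_space))"
  shows "(\<integral>\<^sup>+\<omega>. f (restrict \<omega> {0..<n}) \<partial>traj) = (\<integral>\<^sup>+\<omega>. f \<omega> \<partial>IT.C 0 n (\<lambda>_. undefined))"
proof -
  have r: "(\<lambda>\<omega>. restrict \<omega> {0..<n}) \<in> traj \<rightarrow>\<^sub>M PiM {0..<n} (\<lambda>_. move_space)"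
    unfolding measurable_cong_sets[OF sets_traj refl] by (rule measurable_restrict_subset) simp
  have C: "sets (IT.C 0 n (\<lambda>_. undefined)) = sets (PiM {0..<n} (\<lambda>_. move_space))"
    using IT.sets_C[of "\<lambda>_. undefined" 0 n] by simp
  have "(\<integral>\<^sup>+\<omega>. f (restrict \<omega> {0..<n}) \<partial>traj) =
    (\<integral>\<^sup>+\<omega>. f \<omega> \<partial>distr traj (PiM {0..<n} (\<lambda>_. move_space)) (\<lambda>\<omega>. restrict \<omega> {0..<n}))"
    using f by (subst nn_integral_distr[OF r]) auto
  also have "\<dots> = (\<integral>\<^sup>+\<omega>. f \<omega> \<partial>IT.CI {0..<n})"
    unfolding trajectory_eq by (subst IT.distr_lim) auto
  also have "\<dots> = (\<integral>\<^sup>+\<omega>. f (restrict \<omega> {0..<n}) \<partial>IT.C 0 n (\<lambda>_. undefined))"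
    unfolding IT.CI_def up_to_Ico
    by (subst nn_integral_distr) (use f in \<open>auto simp: measurable_cong_sets[OF C refl] intro: measurable_restrict_subset\<close>)
  also have "\<dots> = (\<integral>\<^sup>+\<omega>. f \<omega> \<partial>IT.C 0 n (\<lambda>_. undefined))"
  proof (rule nn_integral_cong)
    fix \<omega> assume "\<omega> \<in> space (IT.C 0 n (\<lambda>_. undefined))"
    then have "\<omega> \<in> space (PiM {0..<n} (\<lambda>_. move_space))" using sets_eq_imp_space_eq[OF C] by simp
    then have "restrict \<omega> {0..<n} = \<omega>" by (auto simp: space_PiM PiE_restrict)
    then show "f (restrict \<omega> {0..<n}) = f \<omega>" by simp
  qed
  finally show ?thesis .
qed

text \<open>The tower property: the last move is integrated out first, given the earlier ones.
  Together with total mass 1 it is the source of all expectations computed below.\<close>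

lemma nn_integral_traj_Suc:
  fixes G :: "'v history \<Rightarrow> ennreal"
  assumes G: "(\<lambda>\<omega>. G (map \<omega> [0..<Suc n])) \<in> borel_measurable (PiM {0..<Suc n} (\<lambda>_. move_space))"
  shows "(\<integral>\<^sup>+\<omega>. G (map \<omega> [0..<Suc n]) \<partial>traj) =
    (\<integral>\<^sup>+\<omega>. \<integral>\<^sup>+x. G (map \<omega> [0..<n] @ [x]) \<partial>next_move N p \<pi> (h @ map \<omega> [0..<n]) \<partial>traj)"
proof -
  let ?f = "\<lambda>\<omega>. G (map \<omega> [0..<Suc n])"
  let ?u = "\<lambda>_::nat. undefined :: 'v \<times> real"
  have u: "?u \<in> space (PiM {0..<0} (\<lambda>_. move_space))" by simp
  have restr: "map (restrict \<omega> {0..<m}) [0..<m] = map \<omega> [0..<m]" for \<omega> :: "nat \<Rightarrow> 'v \<times> real" and m by auto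
  have eP: "(\<integral>\<^sup>+\<omega>'. ?f \<omega>' \<partial>IT.eP n \<omega>) =
      (\<integral>\<^sup>+x. G (map \<omega> [0..<n] @ [x]) \<partial>next_move N p \<pi> (h @ map \<omega> [0..<n]))"
    if "\<omega> \<in> space (PiM {0..<n} (\<lambda>_. move_space))" for \<omega>
  proof -
    have "map (fun_upd \<omega> n x) [0..<Suc n] = map \<omega> [0..<n] @ [x]" for x by simp
    then show ?thesis unfolding IT.nn_integral_eP[OF that G] by simp
  qed
  have m: "(\<lambda>\<omega>. \<integral>\<^sup>+\<omega>'. ?f \<omega>' \<partial>IT.eP n \<omega>) \<in> borel_measurable (PiM {0..<n} (\<lambda>_. move_space))"
    by (rule measurable_compose[OF IT.measurable_eP nn_integral_measurable_subprob_algebra[OF G]])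
  have spC: "space (IT.C 0 n ?u) = space (PiM {0..<n} (\<lambda>_. move_space))"
    using IT.space_C[OF u, of n] by simp
  have "(\<integral>\<^sup>+\<omega>. ?f \<omega> \<partial>traj) = (\<integral>\<^sup>+\<omega>. ?f (restrict \<omega> {0..<Suc n}) \<partial>traj)"
    unfolding restr ..
  also have "\<dots> = (\<integral>\<^sup>+\<omega>. ?f \<omega> \<partial>IT.C 0 (Suc n) ?u)" by (rule nn_integral_traj[OF G])
  also have "\<dots> = (\<integral>\<^sup>+\<omega>. \<integral>\<^sup>+\<omega>'. ?f \<omega>' \<partial>IT.eP n \<omega> \<partial>IT.C 0 n ?u)"
    unfolding IT.C.simps add_0
    by (rule nn_integral_bind[OF G], subst measurable_cong_sets[OF IT.sets_C[OF u, of n, unfolded add_0] refl])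
      (rule IT.measurable_eP)
  also have "\<dots> = (\<integral>\<^sup>+\<omega>. \<integral>\<^sup>+\<omega>'. ?f \<omega>' \<partial>IT.eP n (restrict \<omega> {0..<n}) \<partial>traj)"
    by (rule nn_integral_traj[OF m, symmetric])
  also have "\<dots> = (\<integral>\<^sup>+\<omega>. \<integral>\<^sup>+x. G (map \<omega> [0..<n] @ [x]) \<partial>next_move N p \<pi> (h @ map \<omega> [0..<n]) \<partial>traj)"
    by (subst eP) (auto simp: space_PiM space_pair_measure restr)
  finally show ?thesis .
qed

end

section \<open>Expectations along a trajectory\<close>

context robust_routing begin

definition proper_move :: "'v history \<Rightarrow> 'v \<times> real \<Rightarrow> bool" where
  "proper_move h' x \<longleftrightarrow> (if h' \<in> histories N \<and> current N h' \<noteq> dest N then h' @ [x] \<in> histories N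
     else x = (dest N, 0))"

text \<open>Almost every trajectory satisfies this (\<open>AE_proper\<close>), so that arrival and
  divergence can be studied pathwise.\<close>

definition proper :: "'v history \<Rightarrow> (nat \<Rightarrow> 'v \<times> real) \<Rightarrow> bool" where
  "proper h \<omega> \<longleftrightarrow> (\<forall>n. proper_move (h @ map \<omega> [0..<n]) (\<omega> n))"

lemma total_cost_ge: "ennreal (spent h) \<le> total_cost h \<omega>"
  by (simp add: total_cost_def)

context
  fixes h \<omega> assumes h: "h \<in> histories N" and proper: "proper h \<omega>"
begin

text \<open>The disjunction is needed because a list that contains dummy moves after arrival is no
  longer in \<open>histories N\<close>.\<close>

lemma proper_stage: "h @ map \<omega> [0..<n] \<in> histories N \<or> current N (h @ map \<omega> [0..<n]) = dest N"
proof (induction n)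
  case (Suc n)
  with proper show ?case
    by (auto simp: proper_def proper_move_def split: if_splits dest!: spec[of _ n])
qed (simp add: h)

lemma proper_cost_nonneg: "0 \<le> snd (\<omega> n)"
proof -
  have "proper_move (h @ map \<omega> [0..<n]) (\<omega> n)" using proper by (simp add: proper_def)
  then show ?thesis
    using arc_lower_pos[of "(current N (h @ map \<omega> [0..<n]), fst (\<omega> n))"]
    by (auto simp: proper_move_def histories_snoc_iff simp del: append_assoc split: if_splits)
qed

lemma proper_absorbed:
  assumes "current N (h @ map \<omega> [0..<n]) = dest N"
  shows "current N (h @ map \<omega> [0..<n + k]) = dest N \<and>
    spent (h @ map \<omega> [0..<n + k]) = spent (h @ map \<omega> [0..<n])"
proof (induction k)
  case (Suc k)
  then have "\<omega> (n + k) = (dest N, 0)"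
    using proper by (auto simp: proper_def proper_move_def dest!: spec[of _ "n + k"])
  with Suc show ?case by (simp add: current_def)
qed (simp add: assms)

lemma spent_stage_le_total: "ennreal (spent (h @ map \<omega> [0..<n])) \<le> total_cost h \<omega>"
  and spent_stage_tendsto: "(\<lambda>n. ennreal (spent (h @ map \<omega> [0..<n]))) \<longlonglongrightarrow> total_cost h \<omega>"
  and spent_stage_ge: "spent h \<le> spent (h @ map \<omega> [0..<n])"
proof -
  have eq: "ennreal (spent (h @ map \<omega> [0..<n])) = ennreal (spent h) + (\<Sum>i<n. ennreal (snd (\<omega> i)))" for n
    using spent_nonneg[OF h] proper_cost_nonneg
    by (simp add: spent_map_upt sum_ennreal ennreal_plus sum_nonneg del: ennreal_plus flip: ennreal_plus)
  show "ennreal (spent (h @ map \<omega> [0..<n])) \<le> total_cost h \<omega>"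
    unfolding eq total_cost_def by (intro add_left_mono sum_le_suminf) auto
  show "(\<lambda>n. ennreal (spent (h @ map \<omega> [0..<n]))) \<longlonglongrightarrow> total_cost h \<omega>"
    unfolding eq total_cost_def by (intro tendsto_intros summable_LIMSEQ) auto
  show "spent h \<le> spent (h @ map \<omega> [0..<n])"
    using proper_cost_nonneg by (simp add: spent_map_upt sum_nonneg)
qed

lemma spent_stage_unbounded:
  assumes never: "\<And>n. current N (h @ map \<omega> [0..<n]) \<noteq> dest N"
  shows "filterlim (\<lambda>n. spent (h @ map \<omega> [0..<n])) at_top sequentially"
proof -
  have hist: "h @ map \<omega> [0..<n] \<in> histories N" for n using proper_stage never by blast
  define d where "d = Min (lower N ` parcs (graph N))"
  have arc: "(current N (h @ map \<omega> [0..<n]), fst (\<omega> n)) \<in> parcs (graph N)"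
    "lower N (current N (h @ map \<omega> [0..<n]), fst (\<omega> n)) \<le> snd (\<omega> n)" for n
    using hist[of "Suc n"] histories_snoc_iff[of "h @ map \<omega> [0..<n]" "\<omega> n" N] by auto
  have d: "d \<le> lower N a" if "a \<in> parcs (graph N)" for a
    unfolding d_def using that finite_arcs by (intro Min_le) auto
  have "d \<in> lower N ` parcs (graph N)" unfolding d_def using arc(1) finite_arcs by (intro Min_in) auto
  then have "d > 0" using arc_lower_pos by auto
  have le: "spent h + real n * d \<le> spent (h @ map \<omega> [0..<n])" for n
  proof (induction n)
    case (Suc n)
    have "d \<le> snd (\<omega> n)" using d[OF arc(1)[of n]] arc(2)[of n] by linarith
    with Suc show ?case by (simp add: spent_map_upt algebra_simps)
  qed (simp add: spent_def)
  have "filterlim (\<lambda>n. spent h + real n * d) at_top sequentially"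
    using \<open>d > 0\<close> by real_asymp
  then show ?thesis by (rule filterlim_at_top_mono) (rule always_eventually, rule allI, rule le)
qed

end

end

context routing_run begin

lemma measurable_stage:
  fixes \<psi> :: "'v \<Rightarrow> real \<Rightarrow> ennreal"
  assumes "\<And>i. \<psi> i \<in> borel_measurable borel" "\<And>i. i \<notin> pverts (graph N) \<Longrightarrow> \<psi> i = \<psi> (dest N)"
    and n: "{0..<n} \<subseteq> I"
  shows "(\<lambda>\<omega>. \<psi> (current N (h @ map \<omega> [0..<n])) (spent (h @ map \<omega> [0..<n])))
    \<in> borel_measurable (PiM I (\<lambda>_. move_space))"
  by (rule measurable_compose_node[OF measurable_current[OF n], where f="\<lambda>i \<omega>. \<psi> i (spent (h @ map \<omega> [0..<n]))"])
    (use measurable_compose[OF measurable_spent[OF n] assms(1)] assms(2) in auto)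

lemma emeasure_traj: "emeasure traj (space traj) = 1"
proof -
  have "(\<integral>\<^sup>+\<omega>. 1 \<partial>traj) = (\<integral>\<^sup>+\<omega>. 1 \<partial>IT.C 0 0 (\<lambda>_. undefined))"
    by (rule nn_integral_traj[of "\<lambda>_. 1"]) simp
  also have "\<dots> = 1" unfolding IT.C.simps by (subst nn_integral_return) auto
  finally show ?thesis by simp
qed

lemma nn_integral_dummy:
  "g \<in> borel_measurable move_space \<Longrightarrow> (\<integral>\<^sup>+x. g x \<partial>dummy) = g (dest N, 0)"
  by (subst nn_integral_return) (auto simp: space_pair_measure)

lemma pred_proper_move: "Measurable.pred move_space (\<lambda>x. h' @ [x] \<in> histories N)"
proof -
  have "(\<lambda>x. (current N h', x)) \<in> move_space \<rightarrow>\<^sub>M count_space UNIV \<Otimes>\<^sub>M move_space" by measurable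
  from measurable_compose[OF this measurable_move_ok]
  have [measurable]: "Measurable.pred move_space (\<lambda>x. (current N h', fst x) \<in> parcs (graph N) \<and>
     snd x \<in> {lower N (current N h', fst x)..upper N (current N h', fst x)})"
    by simp
  show ?thesis unfolding histories_snoc_iff by measurable
qed

lemma nn_integral_improper:
  "(\<integral>\<^sup>+x. (if proper_move h' x then 0 else 1) \<partial>next_move N p \<pi> h') = 0"
proof (cases "h' \<in> histories N \<and> current N h' \<noteq> dest N")
  case True
  then have h': "h' \<in> histories N" "current N h' \<noteq> dest N" by auto
  note [measurable] = pred_proper_move[of h']
  let ?g = "\<lambda>x. if h' @ [x] \<in> histories N then 0 else 1 :: ennreal"
  have "(\<integral>\<^sup>+x. (if proper_move h' x then 0 else 1) \<partial>next_move N p \<pi> h') = (\<integral>\<^sup>+x. ?g x \<partial>next_move N p \<pi> h')"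
    using h' by (simp add: proper_move_def)
  also have "\<dots> = (\<Sum>j\<in>successors N (current N h').
    ennreal (pmf (\<pi> h') j) * (\<integral>\<^sup>+c. ?g (j, c) \<partial>p (spent h') (current N h', j)))"
    by (rule nn_integral_next_move[OF h']) measurable
  also have "\<dots> = 0"
  proof (intro sum.neutral ballI)
    fix j assume "j \<in> successors N (current N h')"
    then have a: "(current N h', j) \<in> parcs (graph N)" by simp
    have "AE c in p (spent h') (current N h', j). ?g (j, c) = 0"
      using ambiguity_arc(5)[OF a p_ambiguity[OF spent_nonneg[OF h'(1)] a]]
      by eventually_elim (use h' a in \<open>auto simp: histories_snoc_iff\<close>)
    then have "(\<integral>\<^sup>+c. ?g (j, c) \<partial>p (spent h') (current N h', j)) = (\<integral>\<^sup>+c. 0 \<partial>p (spent h') (current N h', j))"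
      by (rule nn_integral_cong_AE)
    then show "ennreal (pmf (\<pi> h') j) * (\<integral>\<^sup>+c. ?g (j, c) \<partial>p (spent h') (current N h', j)) = 0" by simp
  qed
  finally show ?thesis .
next
  case False
  have [measurable]: "Measurable.pred move_space (\<lambda>x. x = (dest N, 0 :: real))"
  proof -
    have "Measurable.pred move_space (\<lambda>x. fst x = dest N \<and> snd x = 0)" by measurable
    then show ?thesis by (simp add: prod_eq_iff)
  qed
  have "(\<integral>\<^sup>+x. (if proper_move h' x then 0 else 1) \<partial>next_move N p \<pi> h') =
    (\<integral>\<^sup>+x. (if x = (dest N, 0) then 0 else 1) \<partial>dummy)"
    using False by (subst next_move_dummy) (auto simp: proper_move_def intro!: nn_integral_cong)
  also have "\<dots> = 0" by (subst nn_integral_dummy) auto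
  finally show ?thesis .
qed

lemma AE_proper: "AE \<omega> in traj. proper h \<omega>"
  unfolding proper_def AE_all_countable
proof
  fix n
  \<comment> \<open>The indicator of an improper last move, written as a function of the list of
    moves to fit the tower property.\<close>
  define G where "G xs = (if proper_move (h @ butlast xs) (last xs) then 0 else 1 :: ennreal)" for xs
  have G: "(\<lambda>\<omega>. G (map \<omega> [0..<Suc n])) \<in> borel_measurable (PiM I (\<lambda>_. move_space))"
    if n: "{0..<Suc n} \<subseteq> I" for I
  proof -
    have n': "{0..<n} \<subseteq> I" and [measurable]: "n \<in> I" using n by auto
    note [measurable] = measurable_histories[OF n, of h] measurable_histories[OF n', of h] measurable_current[OF n', of h]
    have "Measurable.pred (PiM I (\<lambda>_. move_space)) (\<lambda>\<omega>. fst (\<omega> n) = dest N \<and> snd (\<omega> n) = 0)" by measurable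
    then have [measurable]: "Measurable.pred (PiM I (\<lambda>_. move_space)) (\<lambda>\<omega>. \<omega> n = (dest N, 0))"
      by (simp add: prod_eq_iff)
    define A where "A \<omega> \<longleftrightarrow> h @ map \<omega> [0..<n] \<in> histories N \<and> current N (h @ map \<omega> [0..<n]) \<noteq> dest N" for \<omega>
    define B where "B \<omega> \<longleftrightarrow> h @ map \<omega> [0..<Suc n] \<in> histories N" for \<omega>
    have [measurable]: "Measurable.pred (PiM I (\<lambda>_. move_space)) A" unfolding A_def[abs_def] by measurable
    have [measurable]: "Measurable.pred (PiM I (\<lambda>_. move_space)) B"
      unfolding B_def[abs_def] by (rule measurable_histories[OF n])
    have "(\<lambda>\<omega>. if (if A \<omega> then B \<omega> else \<omega> n = (dest N, 0)) then 0 else 1 :: ennreal)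
      \<in> borel_measurable (PiM I (\<lambda>_. move_space))"
      by measurable
    then show ?thesis by (simp add: G_def proper_move_def A_def B_def cong: if_cong)
  qed
  have "(\<integral>\<^sup>+\<omega>. G (map \<omega> [0..<Suc n]) \<partial>traj) =
    (\<integral>\<^sup>+\<omega>. \<integral>\<^sup>+x. G (map \<omega> [0..<n] @ [x]) \<partial>next_move N p \<pi> (h @ map \<omega> [0..<n]) \<partial>traj)"
    by (rule nn_integral_traj_Suc[OF G]) simp
  also have "\<dots> = 0" by (simp add: G_def nn_integral_improper)
  finally have "AE \<omega> in traj. G (map \<omega> [0..<Suc n]) = 0"
    using G[of UNIV] by (subst (asm) nn_integral_0_iff_AE) (simp_all add: measurable_cong_sets[OF sets_traj refl])
  then show "AE \<omega> in traj. proper_move (h @ map \<omega> [0..<n]) (\<omega> n)"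
    by (rule eventually_mono) (auto simp: G_def split: if_splits)
qed

context
  fixes \<psi> :: "'v \<Rightarrow> real \<Rightarrow> ennreal"
  assumes \<psi>: "\<And>i. \<psi> i \<in> borel_measurable borel" "\<And>i. i \<notin> pverts (graph N) \<Longrightarrow> \<psi> i = \<psi> (dest N)"
begin

abbreviation "stage n \<omega> \<equiv> \<psi> (current N (h @ map \<omega> [0..<n])) (spent (h @ map \<omega> [0..<n]))"

text \<open>The conditional expectation of the stage value after one more move, given that the
  history so far is \<open>h'\<close>.\<close>

definition "next_stage h' = (\<integral>\<^sup>+x. \<psi> (fst x) (spent h' + snd x) \<partial>next_move N p \<pi> h')"

lemma measurable_next_stage: "(\<lambda>x. \<psi> (fst x) (r + snd x)) \<in> borel_measurable move_space"
proof (rule measurable_compose_node[where f="\<lambda>i x. \<psi> i (r + snd x)"])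
  show "(\<lambda>x. \<psi> i (r + snd x)) \<in> borel_measurable move_space" for i
    by (rule measurable_compose[OF _ \<psi>(1)]) measurable
qed (auto simp: \<psi>(2))

lemma next_stage_sum:
  assumes "h' \<in> histories N" "current N h' \<noteq> dest N"
  shows "next_stage h' = (\<Sum>j\<in>successors N (current N h').
    ennreal (pmf (\<pi> h') j) * (\<integral>\<^sup>+c. \<psi> j (spent h' + c) \<partial>p (spent h') (current N h', j)))"
  unfolding next_stage_def nn_integral_next_move[OF assms measurable_next_stage] by simp

text \<open>Dummy moves cost nothing, so the process is stopped at the destination and the
  martingale conditions have to be checked only before.\<close>

lemma next_stage_dest: "current N h' = dest N \<Longrightarrow> next_stage h' = \<psi> (dest N) (spent h')"
  unfolding next_stage_def by (simp add: next_move_dummy nn_integral_dummy measurable_next_stage)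

lemma nn_integral_stage_0: "(\<integral>\<^sup>+\<omega>. stage 0 \<omega> \<partial>traj) = \<psi> (current N h) (spent h)"
  using emeasure_traj by (simp add: spent_def)

lemma nn_integral_stage_Suc: "(\<integral>\<^sup>+\<omega>. stage (Suc n) \<omega> \<partial>traj) = (\<integral>\<^sup>+\<omega>. next_stage (h @ map \<omega> [0..<n]) \<partial>traj)"
proof -
  define G where "G xs = \<psi> (current N (h @ xs)) (spent (h @ xs))" for xs
  have "(\<integral>\<^sup>+\<omega>. stage (Suc n) \<omega> \<partial>traj) = (\<integral>\<^sup>+\<omega>. G (map \<omega> [0..<Suc n]) \<partial>traj)" by (simp add: G_def)
  also have "\<dots> = (\<integral>\<^sup>+\<omega>. \<integral>\<^sup>+x. G (map \<omega> [0..<n] @ [x]) \<partial>next_move N p \<pi> (h @ map \<omega> [0..<n]) \<partial>traj)"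
    by (rule nn_integral_traj_Suc, unfold G_def, rule measurable_stage[of \<psi>, OF \<psi> subset_refl])
  also have "\<dots> = (\<integral>\<^sup>+\<omega>. next_stage (h @ map \<omega> [0..<n]) \<partial>traj)"
    by (simp add: G_def next_stage_def current_def add.assoc)
  finally show ?thesis .
qed

text \<open>The relation \<open>R\<close> is instantiated with both orders, for the supermartingale
  and the submartingale. The one-step condition is asked only where
  \<open>spent h \<le> spent h'\<close>; this is how estimates valid for large excess become
  applicable.\<close>

lemma nn_integral_stage_Suc_mono:
  assumes rel: "\<And>x :: ennreal. R x x"
    and R: "\<And>f g :: (nat \<Rightarrow> 'v \<times> real) \<Rightarrow> ennreal. AE \<omega> in traj. R (f \<omega>) (g \<omega>) \<Longrightarrow> R (\<integral>\<^sup>+\<omega>. f \<omega> \<partial>traj) (\<integral>\<^sup>+\<omega>. g \<omega> \<partial>traj)"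
    and step: "\<And>h'. h' \<in> histories N \<Longrightarrow> current N h' \<noteq> dest N \<Longrightarrow> spent h \<le> spent h' \<Longrightarrow>
      R (next_stage h') (\<psi> (current N h') (spent h'))"
  shows "R (\<integral>\<^sup>+\<omega>. stage (Suc n) \<omega> \<partial>traj) (\<integral>\<^sup>+\<omega>. stage n \<omega> \<partial>traj)"
  unfolding nn_integral_stage_Suc
proof (rule R)
  show "AE \<omega> in traj. R (next_stage (h @ map \<omega> [0..<n])) (stage n \<omega>)"
    using AE_proper
  proof eventually_elim
    case (elim \<omega>)
    show ?case
    proof (cases "current N (h @ map \<omega> [0..<n]) = dest N")
      case True
      then show ?thesis using rel by (simp add: next_stage_dest)
    next
      case False
      with proper_stage[OF history elim, of n] show ?thesis
        by (intro step spent_stage_ge[OF history elim]) auto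
    qed
  qed
qed

lemma nn_integral_stage_le:
  assumes "\<And>h'. h' \<in> histories N \<Longrightarrow> current N h' \<noteq> dest N \<Longrightarrow> spent h \<le> spent h' \<Longrightarrow>
      next_stage h' \<le> \<psi> (current N h') (spent h')"
  shows "(\<integral>\<^sup>+\<omega>. stage n \<omega> \<partial>traj) \<le> \<psi> (current N h) (spent h)"
proof (induction n)
  case 0
  then show ?case using nn_integral_stage_0 by simp
next
  case (Suc n)
  have "(\<integral>\<^sup>+\<omega>. stage (Suc n) \<omega> \<partial>traj) \<le> (\<integral>\<^sup>+\<omega>. stage n \<omega> \<partial>traj)"
    by (rule nn_integral_stage_Suc_mono[where R="(\<le>)"]) (auto intro: nn_integral_mono_AE assms)
  with Suc show ?case by simp
qed

text \<open>The bound starts from \<open>next_stage h\<close> and not from the value at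
  \<open>h\<close>: the former still shows the weights that \<open>\<pi>\<close> gives to the arcs
  out of \<open>h\<close>, from which the conclusion on optimal strategies is drawn.\<close>

lemma nn_integral_stage_ge:
  assumes "\<And>h'. h' \<in> histories N \<Longrightarrow> current N h' \<noteq> dest N \<Longrightarrow> spent h \<le> spent h' \<Longrightarrow>
      \<psi> (current N h') (spent h') \<le> next_stage h'"
  shows "next_stage h \<le> (\<integral>\<^sup>+\<omega>. stage (Suc n) \<omega> \<partial>traj)"
proof (induction n)
  case 0
  then show ?case unfolding nn_integral_stage_Suc using emeasure_traj by simp
next
  case (Suc n)
  have "(\<integral>\<^sup>+\<omega>. stage (Suc n) \<omega> \<partial>traj) \<le> (\<integral>\<^sup>+\<omega>. stage (Suc (Suc n)) \<omega> \<partial>traj)"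
    by (rule nn_integral_stage_Suc_mono[where R="(\<ge>)"]) (auto intro: nn_integral_mono_AE assms)
  with Suc show ?case by simp
qed

end

end

section \<open>Bounds for the robust problem\<close>

context tail_loss begin

definition final_loss :: "real \<Rightarrow> ennreal \<Rightarrow> ennreal" where
  "final_loss T x = (if x = \<infinity> then \<infinity> else ennreal (l (enn2real x - T)))"

abbreviation "stage_loss T h' \<equiv> ennreal (node_loss (current N h') (spent h' - T))"

text \<open>After arrival the stage loss is constant and equal to the final loss. Without arrival
  the spent cost diverges, and \<open>l\<close>, which bounds all node losses from below, drives
  them to infinity.\<close>

lemma stage_loss_tendsto:
  assumes h: "h \<in> histories N" and proper: "proper h \<omega>"
  shows "(\<lambda>n. stage_loss T (h @ map \<omega> [0..<n])) \<longlonglongrightarrow> final_loss T (total_cost h \<omega>)"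
proof (cases "\<exists>n. current N (h @ map \<omega> [0..<n]) = dest N")
  case True
  then obtain n where n: "current N (h @ map \<omega> [0..<n]) = dest N" by blast
  define r where "r = spent (h @ map \<omega> [0..<n])"
  have r: "r \<ge> 0" using spent_stage_ge[OF h proper, of n] spent_nonneg[OF h] by (simp add: r_def)
  have absorbed: "current N (h @ map \<omega> [0..<m]) = dest N \<and> spent (h @ map \<omega> [0..<m]) = r" if "m \<ge> n" for m
    using proper_absorbed[OF h proper n, of "m - n"] that by (simp add: r_def)
  have "(\<lambda>n. ennreal (spent (h @ map \<omega> [0..<n]))) \<longlonglongrightarrow> ennreal r"
    by (rule tendsto_eventually) (use absorbed in \<open>auto simp: eventually_sequentially simp del: spent_append\<close>)
  with spent_stage_tendsto[OF h proper] have "total_cost h \<omega> = ennreal r" by (rule LIMSEQ_unique)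
  then have "final_loss T (total_cost h \<omega>) = ennreal (l (r - T))" using r by (simp add: final_loss_def)
  moreover have "stage_loss T (h @ map \<omega> [0..<m]) = ennreal (l (r - T))" if "m \<ge> n" for m
    using absorbed[OF that] by (simp add: node_loss_terminal del: spent_append)
  ultimately show ?thesis
    by (intro tendsto_eventually) (auto simp: eventually_sequentially simp del: spent_append)
next
  case False
  then have lim: "filterlim (\<lambda>n. spent (h @ map \<omega> [0..<n])) at_top sequentially"
    by (intro spent_stage_unbounded[OF h proper]) auto
  then have "(\<lambda>n. ennreal (spent (h @ map \<omega> [0..<n]))) \<longlonglongrightarrow> \<infinity>"
    by (simp only: ennreal_tendsto_top_eq_at_top infinity_ennreal_def)
  with spent_stage_tendsto[OF h proper] have "total_cost h \<omega> = \<infinity>" by (rule LIMSEQ_unique)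
  then have "final_loss T (total_cost h \<omega>) = top" by (simp add: final_loss_def)
  moreover have "filterlim (\<lambda>n. spent (h @ map \<omega> [0..<n]) - T) at_top sequentially"
    using filterlim_tendsto_add_at_top[OF tendsto_const lim, of "- T"] by (simp del: spent_append)
  from filterlim_compose[OF loss_at_top this]
  have "filterlim (\<lambda>n. node_loss (current N (h @ map \<omega> [0..<n])) (spent (h @ map \<omega> [0..<n]) - T)) at_top sequentially"
    by (rule filterlim_at_top_mono) (rule always_eventually, rule allI, rule loss_le_node_loss)
  then have "(\<lambda>n. stage_loss T (h @ map \<omega> [0..<n])) \<longlonglongrightarrow> top"
    by (simp only: ennreal_tendsto_top_eq_at_top)
  ultimately show ?thesis by simp
qed

lemma stage_loss_le_final:
  assumes h: "h \<in> histories N" and proper: "proper h \<omega>"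
    and K: "\<And>s i. s \<ge> S \<Longrightarrow> node_loss i s \<le> K * l s" and "S \<le> spent h - T" and "K > 0"
  shows "stage_loss T (h @ map \<omega> [0..<n]) \<le> ennreal K * final_loss T (total_cost h \<omega>)"
proof (cases "total_cost h \<omega>")
  case (real r)
  let ?s = "spent (h @ map \<omega> [0..<n])"
  have "?s \<le> r" using spent_stage_le_total[OF h proper, of n] real by (simp add: ennreal_le_iff del: spent_append)
  have "node_loss (current N (h @ map \<omega> [0..<n])) (?s - T) \<le> K * l (?s - T)"
    using spent_stage_ge[OF h proper, of n] assms(4) by (intro K) auto
  also have "\<dots> \<le> K * l (r - T)"
    using \<open>?s \<le> r\<close> \<open>K > 0\<close> by (intro mult_left_mono monoD[OF loss_mono]) auto
  finally have "stage_loss T (h @ map \<omega> [0..<n]) \<le> ennreal (K * l (r - T))" by (rule ennreal_leI)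
  also have "\<dots> = ennreal K * final_loss T (total_cost h \<omega>)"
    using real \<open>K > 0\<close> loss_ge_1[of "r - T"] by (simp add: final_loss_def ennreal_mult)
  finally show ?thesis .
next
  case top
  then show ?thesis using \<open>K > 0\<close> by (simp add: final_loss_def ennreal_mult_top)
qed

lemma measurable_node_loss [measurable]: "node_loss i \<in> borel_measurable borel"
  by (rule borel_measurable_continuous_onI[OF continuous_node_loss])

lemma node_loss_outside: "i \<notin> pverts (graph N) \<Longrightarrow> node_loss i = node_loss (dest N)"
  by (simp add: node_loss_terminal)

lemma node_loss_ge_1: "1 \<le> node_loss i s"
  using loss_ge_1[of s] loss_le_node_loss[of s i] by linarith

lemma node_loss_nonneg: "0 \<le> node_loss i s"
  using node_loss_ge_1[of i s] by linarith

lemma nn_integral_final_loss_le: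
  assumes run: "routing_run N p \<pi> h" and B: "\<And>n. (\<integral>\<^sup>+\<omega>. stage_loss T (h @ map \<omega> [0..<n]) \<partial>trajectory N p \<pi> h) \<le> B"
  shows "(\<integral>\<^sup>+\<omega>. final_loss T (total_cost h \<omega>) \<partial>trajectory N p \<pi> h) \<le> B"
proof -
  interpret routing_run N p \<pi> h by fact
  have meas: "(\<lambda>\<omega>. stage_loss T (h @ map \<omega> [0..<n])) \<in> borel_measurable traj" for n
    unfolding measurable_cong_sets[OF sets_traj refl]
    by (rule measurable_stage[of "\<lambda>i s. ennreal (node_loss i (s - T))"]) (auto simp: node_loss_outside)
  have "AE \<omega> in traj. final_loss T (total_cost h \<omega>) = liminf (\<lambda>n. stage_loss T (h @ map \<omega> [0..<n]))"
    using AE_proper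
    by eventually_elim (rule lim_imp_Liminf[OF _ stage_loss_tendsto[OF history], symmetric], simp)
  then have "(\<integral>\<^sup>+\<omega>. final_loss T (total_cost h \<omega>) \<partial>traj) =
    (\<integral>\<^sup>+\<omega>. liminf (\<lambda>n. stage_loss T (h @ map \<omega> [0..<n])) \<partial>traj)"
    by (rule nn_integral_cong_AE)
  also have "\<dots> \<le> liminf (\<lambda>n. \<integral>\<^sup>+\<omega>. stage_loss T (h @ map \<omega> [0..<n]) \<partial>traj)"
    by (rule nn_integral_liminf[OF meas])
  also have "\<dots> \<le> liminf (\<lambda>n. B)" by (rule Liminf_mono) (use B in auto)
  also have "\<dots> = B" by (simp add: Liminf_const)
  finally show ?thesis .
qed

text \<open>The lemma of Fatou goes the wrong way here; the bound by \<open>K * l\<close> gives dominated convergence,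
  because \<open>l\<close> increases along a trajectory.\<close>

lemma nn_integral_final_loss_ge:
  assumes run: "routing_run N p \<pi> h"
    and B: "\<And>n. B \<le> (\<integral>\<^sup>+\<omega>. stage_loss T (h @ map \<omega> [0..<Suc n]) \<partial>trajectory N p \<pi> h)"
    and K: "\<And>s i. s \<ge> S \<Longrightarrow> node_loss i s \<le> K * l s" and S: "S \<le> spent h - T" and "K > 0"
  shows "B \<le> (\<integral>\<^sup>+\<omega>. final_loss T (total_cost h \<omega>) \<partial>trajectory N p \<pi> h)"
proof -
  interpret routing_run N p \<pi> h by fact
  \<comment> \<open>\<open>L\<close> equals the final loss almost everywhere and is measurable by
    construction.\<close>
  define L where "L \<omega> = liminf (\<lambda>n. stage_loss T (h @ map \<omega> [0..<n]))" for \<omega>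
  have meas: "(\<lambda>\<omega>. stage_loss T (h @ map \<omega> [0..<n])) \<in> borel_measurable traj" for n
    unfolding measurable_cong_sets[OF sets_traj refl]
    by (rule measurable_stage[of "\<lambda>i s. ennreal (node_loss i (s - T))"]) (auto simp: node_loss_outside)
  have L: "L \<in> borel_measurable traj" unfolding L_def[abs_def] by (intro borel_measurable_liminf meas)
  have eq: "AE \<omega> in traj. final_loss T (total_cost h \<omega>) = L \<omega>"
    using AE_proper unfolding L_def
    by eventually_elim (rule lim_imp_Liminf[OF _ stage_loss_tendsto[OF history], symmetric], simp)
  then have int: "(\<integral>\<^sup>+\<omega>. final_loss T (total_cost h \<omega>) \<partial>traj) = (\<integral>\<^sup>+\<omega>. L \<omega> \<partial>traj)"
    by (rule nn_integral_cong_AE)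
  show ?thesis
  proof (cases "(\<integral>\<^sup>+\<omega>. L \<omega> \<partial>traj) = \<infinity>")
    case True
    then show ?thesis by (simp add: int)
  next
    case False
    have "(\<lambda>n. \<integral>\<^sup>+\<omega>. stage_loss T (h @ map \<omega> [0..<n]) \<partial>traj) \<longlonglongrightarrow> (\<integral>\<^sup>+\<omega>. L \<omega> \<partial>traj)"
    proof (rule nn_integral_dominated_convergence[OF meas L, where w="\<lambda>\<omega>. ennreal K * L \<omega>"])
      show "(\<lambda>\<omega>. ennreal K * L \<omega>) \<in> borel_measurable traj" using L by measurable
      show "AE \<omega> in traj. stage_loss T (h @ map \<omega> [0..<n]) \<le> ennreal K * L \<omega>" for n
        using eq AE_proper
      proof eventually_elim
        case (elim \<omega>)
        show ?case
          using stage_loss_le_final[OF history elim(2) K S \<open>K > 0\<close>, of n] elim(1) by simp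
      qed
      show "(\<integral>\<^sup>+\<omega>. ennreal K * L \<omega> \<partial>traj) < \<infinity>"
        using False by (subst nn_integral_cmult[OF L]) (simp add: ennreal_mult_less_top less_top)
      show "AE \<omega> in traj. (\<lambda>n. stage_loss T (h @ map \<omega> [0..<n])) \<longlonglongrightarrow> L \<omega>"
        using eq AE_proper
      proof eventually_elim
        case (elim \<omega>)
        show ?case using stage_loss_tendsto[OF history elim(2), of T] elim(1) by simp
      qed
    qed
    from LIMSEQ_Suc[OF this] show ?thesis
      unfolding int by (rule LIMSEQ_le_const) (use B in auto)
  qed
qed

lemma nn_integral_node_loss:
  assumes a: "a \<in> parcs (graph N)" "q \<in> ambiguity N a"
  shows "(\<integral>\<^sup>+c. ennreal (node_loss j (s + c)) \<partial>q) = ennreal (\<integral>c. node_loss j (s + c) \<partial>q)"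
  by (rule nn_integral_eq_integral)
    (use integrable_continuous[OF a continuous_shift[OF a(1) continuous_node_loss]]
      in \<open>simp_all add: node_loss_nonneg\<close>)

section \<open>The minimizing strategy and the upper bound\<close>

definition best_successors :: "'v \<Rightarrow> real \<Rightarrow> 'v set" where
  "best_successors i s = {j \<in> tree_successors N i. node_loss i s = arc_loss (i, j) (node_loss j) s}"

definition best_successor :: "'v \<Rightarrow> real \<Rightarrow> 'v" where
  "best_successor i s = (if i \<in> pverts (graph N) \<and> i \<noteq> dest N then SOME j. j \<in> best_successors i s else dest N)"

definition best_strategy :: "real \<Rightarrow> 'v history \<Rightarrow> 'v pmf" where
  "best_strategy T h' = return_pmf (best_successor (current N h') (spent h' - T))"

lemma best_successor:
  assumes "i \<in> pverts (graph N)" "i \<noteq> dest N"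
  shows "best_successor i s \<in> tree_successors N i"
    "node_loss i s = arc_loss (i, best_successor i s) (node_loss (best_successor i s)) s"
proof -
  have "\<exists>j. j \<in> best_successors i s" using node_loss_attained[OF assms, of s] by (auto simp: best_successors_def)
  from someI_ex[OF this] assms have "best_successor i s \<in> best_successors i s" by (simp add: best_successor_def)
  then show "best_successor i s \<in> tree_successors N i"
    "node_loss i s = arc_loss (i, best_successor i s) (node_loss (best_successor i s)) s"
    by (auto simp: best_successors_def)
qed

text \<open>The choice by \<open>SOME\<close> depends on \<open>s\<close> only through the set of
  best successors. This set takes finitely many values, each on a Borel set cut out by equalities of
  continuous functions.\<close>

lemma measurable_best_successor: "best_successor i \<in> borel \<rightarrow>\<^sub>M count_space UNIV"
proof (cases "i \<in> pverts (graph N) \<and> i \<noteq> dest N")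
  case True
  let ?T = "tree_successors N i"
  have [measurable]: "arc_loss (i, j) (node_loss j) \<in> borel_measurable borel" if "j \<in> ?T" for j
    by (intro borel_measurable_continuous_onI continuous_on_arc_loss tree_successors_arc[OF that] continuous_node_loss)
  have "best_successors i \<in> borel \<rightarrow>\<^sub>M count_space (Pow ?T)"
    unfolding measurable_count_space_eq2[OF finite_Pow_iff[THEN iffD2, OF finite_tree_successors]]
  proof (intro conjI ballI)
    show "best_successors i \<in> space borel \<rightarrow> Pow ?T" by (auto simp: best_successors_def)
    fix B assume "B \<in> Pow ?T"
    then have "best_successors i s = B \<longleftrightarrow>
        (\<forall>j\<in>?T. j \<in> B \<longleftrightarrow> node_loss i s = arc_loss (i, j) (node_loss j) s)" for s
      unfolding best_successors_def by blast
    then have "best_successors i -` {B} \<inter> space borel =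
      {s. \<forall>j\<in>?T. j \<in> B \<longleftrightarrow> node_loss i s = arc_loss (i, j) (node_loss j) s}"
      by (simp add: vimage_def)
    also have "\<dots> \<in> sets borel"
    proof -
      have "Measurable.pred borel (\<lambda>s. \<forall>j\<in>?T. j \<in> B \<longleftrightarrow> node_loss i s = arc_loss (i, j) (node_loss j) s)"
        using finite_tree_successors by (intro pred_intros_finite) measurable
      then show ?thesis by (simp add: pred_def)
    qed
    finally show "best_successors i -` {B} \<inter> space borel \<in> sets borel" .
  qed
  from measurable_compose[OF this, of "\<lambda>B. SOME j. j \<in> B" "count_space UNIV"] True
  show ?thesis by (simp add: best_successor_def[abs_def])
next
  case False
  then have "best_successor i = (\<lambda>_. dest N)" by (auto simp: best_successor_def)
  then show ?thesis by simp
qed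

lemma best_strategy: "best_strategy T \<in> strategies N"
  unfolding strategies_def
proof (intro CollectI conjI ballI allI impI)
  fix h' assume "h' \<in> histories N" "current N h' \<noteq> dest N"
  with best_successor(1)[of "current N h'" "spent h' - T"]
  show "set_pmf (best_strategy T h') \<subseteq> successors N (current N h')"
    by (auto simp: best_strategy_def dest: current_in_verts tree_successors_arc)
next
  fix n j
  let ?M = "PiM {0..<n} (\<lambda>_. move_space) :: (nat \<Rightarrow> 'v \<times> real) measure"
  have sp: "(\<lambda>\<omega>. spent (map \<omega> [0..<n]) - T) \<in> borel_measurable ?M"
    using borel_measurable_diff[OF measurable_spent[OF subset_refl, of "[]" n] borel_measurable_const] by simp
  have "(\<lambda>\<omega>. best_successor (current N (map \<omega> [0..<n])) (spent (map \<omega> [0..<n]) - T)) \<in> ?M \<rightarrow>\<^sub>M count_space UNIV"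
  proof (rule measurable_compose_node[where f="\<lambda>i \<omega>. best_successor i (spent (map \<omega> [0..<n]) - T)"])
    show "(\<lambda>\<omega>. current N (map \<omega> [0..<n])) \<in> ?M \<rightarrow>\<^sub>M count_space UNIV"
      using measurable_current[OF subset_refl, of "[]" n] by simp
    show "(\<lambda>\<omega>. best_successor i (spent (map \<omega> [0..<n]) - T)) \<in> ?M \<rightarrow>\<^sub>M count_space UNIV" for i
      by (rule measurable_compose[OF sp measurable_best_successor])
  qed (simp add: best_successor_def)
  from measurable_compose[OF this, of "\<lambda>k. pmf (return_pmf k) j" borel]
  have "(\<lambda>\<omega>. pmf (best_strategy T (map \<omega> [0..<n])) j) \<in> borel_measurable ?M"
    by (simp add: best_strategy_def)
  then show "(\<lambda>\<omega>. pmf (best_strategy T (map \<omega> [0..<n])) j) \<in> borel_measurable (restrict_space ?M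
      {\<omega>. map \<omega> [0..<n] \<in> histories N \<and> current N (map \<omega> [0..<n]) \<noteq> dest N})"
    by (rule measurable_restrict_space1)
qed

text \<open>Whatever distribution nature uses, the mean loss over the chosen arc is at most its
  \<open>arc_loss\<close>, which is the node loss. The recursion holds at every excess, so this
  bound has no threshold, unlike the lower one.\<close>

lemma best_strategy_loss_le:
  assumes p: "p \<in> cost_families N" and h: "h \<in> histories N"
  shows "(\<integral>\<^sup>+\<omega>. final_loss T (total_cost h \<omega>) \<partial>trajectory N p (best_strategy T) h) \<le> stage_loss T h"
proof -
  interpret routing_run N p "best_strategy T" h by unfold_locales (fact p best_strategy h)+
  let ?\<psi> = "\<lambda>i r. ennreal (node_loss i (r - T))"
  have \<psi>: "?\<psi> i \<in> borel_measurable borel" "i \<notin> pverts (graph N) \<Longrightarrow> ?\<psi> i = ?\<psi> (dest N)" for i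
    by (auto simp: node_loss_outside)
  show ?thesis
  proof (rule nn_integral_final_loss_le[OF routing_run_axioms], rule nn_integral_stage_le[of ?\<psi>, OF \<psi>])
    fix h' assume h': "h' \<in> histories N" "current N h' \<noteq> dest N"
    define j where "j = best_successor (current N h') (spent h' - T)"
    note b = best_successor[OF current_in_verts[OF h'(1)] h'(2), of "spent h' - T", folded j_def]
    note a = tree_successors_arc[OF b(1)]
    note amb = p_ambiguity[OF spent_nonneg[OF h'(1)] a]
    have strat: "best_strategy T h' = return_pmf j" by (simp add: best_strategy_def j_def)
    have "next_stage ?\<psi> h' = (\<Sum>k\<in>successors N (current N h'). ennreal (pmf (return_pmf j) k) *
        (\<integral>\<^sup>+c. ennreal (node_loss k (spent h' + c - T)) \<partial>p (spent h') (current N h', k)))"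
      by (rule trans[OF next_stage_sum[of ?\<psi>, OF \<psi> h']], assumption) (simp only: strat)
    also have "\<dots> = (\<Sum>k\<in>successors N (current N h'). if k = j then
        (\<integral>\<^sup>+c. ennreal (node_loss k (spent h' + c - T)) \<partial>p (spent h') (current N h', k)) else 0)"
      by (intro sum.cong refl) (auto simp: pmf_return)
    also have "\<dots> = (\<integral>\<^sup>+c. ennreal (node_loss j (spent h' + c - T)) \<partial>p (spent h') (current N h', j))"
      using a finite_successors by (subst sum.delta) auto
    also have "\<dots> = (\<integral>\<^sup>+c. ennreal (node_loss j ((spent h' - T) + c)) \<partial>p (spent h') (current N h', j))"
      by (simp add: algebra_simps)
    also have "\<dots> \<le> ennreal (arc_loss (current N h', j) (node_loss j) (spent h' - T))"
      unfolding nn_integral_node_loss[OF a amb]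
      by (intro ennreal_leI integral_le_arc_loss[OF a continuous_node_loss amb])
    finally show "next_stage ?\<psi> h' \<le> stage_loss T h'" using b(2) by simp
  qed
qed

section \<open>Nearly worst cost families and the lower bound\<close>

lemma lower_bound_pos: "\<exists>d>0. \<forall>a\<in>parcs (graph N). d \<le> lower N a"
proof (intro exI conjI ballI)
  \<comment> \<open>The 1 keeps the set nonempty when the graph has no arcs.\<close>
  let ?A = "insert 1 (lower N ` parcs (graph N))"
  have "Min ?A \<in> ?A" using finite_arcs by (intro Min_in) auto
  then show "Min ?A > 0" using arc_lower_pos by fastforce
  show "Min ?A \<le> lower N a" if "a \<in> parcs (graph N)" for a using that finite_arcs by (intro Min_le) auto
qed

text \<open>The slack \<open>\<kappa> * exp (- s)\<close> shrinks at least by the factor \<open>exp (- d)\<close> with every arc, which pays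
  for the choice of a distribution that is only nearly worst: the stage losses reduced by the slack
  form a submartingale.\<close>

lemma near_worst_family:
  assumes "\<kappa> > 0"
  obtains p where "p \<in> cost_families N"
    "\<And>\<tau> i j. \<tau> \<ge> 0 \<Longrightarrow> (i, j) \<in> parcs (graph N) \<Longrightarrow>
      ennreal (arc_loss (i, j) (node_loss j) (\<tau> - T) - \<kappa> * exp (- (\<tau> - T))) \<le>
      (\<integral>\<^sup>+c. ennreal (node_loss j (\<tau> + c - T) - \<kappa> * exp (- (\<tau> + c - T))) \<partial>p \<tau> (i, j))"
proof -
  obtain d where d: "d > 0" "\<And>a. a \<in> parcs (graph N) \<Longrightarrow> d \<le> lower N a" using lower_bound_pos by blast
  \<comment> \<open>The decrease of the slack when the excess grows from \<open>s\<close> to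
    \<open>s + d\<close>.\<close>
  define e where "e s = \<kappa> * exp (- s) * (1 - exp (- d))" for s
  have e: "e \<in> borel_measurable borel" "\<And>s. e s > 0"
    using assms d by (auto simp: e_def[abs_def])
  have "\<exists>q. q \<in> borel \<rightarrow>\<^sub>M prob_algebra borel \<and> (\<forall>s. q s \<in> ambiguity N a \<and>
      arc_loss a (node_loss (snd a)) s - e s \<le> (\<integral>c. node_loss (snd a) (s + c) \<partial>q s))"
    if "a \<in> parcs (graph N)" for a
    using measurable_near_worst[OF that continuous_node_loss e] by metis
  then obtain q where q: "\<And>a. a \<in> parcs (graph N) \<Longrightarrow> q a \<in> borel \<rightarrow>\<^sub>M prob_algebra borel"
    "\<And>a s. a \<in> parcs (graph N) \<Longrightarrow> q a s \<in> ambiguity N a"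
    "\<And>a s. a \<in> parcs (graph N) \<Longrightarrow>
      arc_loss a (node_loss (snd a)) s - e s \<le> (\<integral>c. node_loss (snd a) (s + c) \<partial>q a s)"
    by metis
  show thesis
  proof
    have "(\<lambda>\<tau>. q a (\<tau> - T)) \<in> restrict_space borel {0..} \<rightarrow>\<^sub>M prob_algebra borel" if "a \<in> parcs (graph N)" for a
      by (intro measurable_restrict_space1 measurable_compose[OF _ q(1)[OF that]]) measurable
    then show "(\<lambda>\<tau> a. q a (\<tau> - T)) \<in> cost_families N" using q(2) by (auto simp: cost_families_def)
    fix \<tau> i j assume a: "(i, j) \<in> parcs (graph N)"
    define s where "s = \<tau> - T"
    define Q where "Q = q (i, j) s"
    have Q: "Q \<in> ambiguity N (i, j)" using q(2)[OF a] by (simp add: Q_def)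
    interpret prob_space Q by (rule ambiguity_arc[OF a Q])
    let ?g = "\<lambda>c. node_loss j (s + c) - \<kappa> * exp (- (s + c))"
    let ?k = "\<lambda>c. node_loss j (s + c) - \<kappa> * exp (- s) * exp (- d)"
    note shift = continuous_shift[OF a continuous_node_loss[of j], of s]
    have cont: "continuous_on UNIV ?g" "continuous_on UNIV ?k"
      by (intro continuous_on_diff shift continuous_intros)+
    \<comment> \<open>Since \<open>ennreal\<close> truncates at 0, the real integrals are compared
      with the positive part of the reduced loss.\<close>
    have cont_max: "continuous_on UNIV (\<lambda>c. max 0 (?g c))"
      by (intro continuous_on_max continuous_on_const cont)
    have int: "integrable Q (\<lambda>c. node_loss j (s + c))"
      by (rule integrable_continuous[OF a Q shift])
    have "arc_loss (i, j) (node_loss j) s - \<kappa> * exp (- s) \<le> (\<integral>c. node_loss j (s + c) \<partial>Q) - \<kappa> * exp (- s) * exp (- d)"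
      using q(3)[OF a, of s] by (simp add: e_def Q_def algebra_simps)
    also have "\<dots> = (\<integral>c. ?k c \<partial>Q)" using int by (simp add: prob_space)
    also have "\<dots> \<le> (\<integral>c. max 0 (?g c) \<partial>Q)"
    proof (rule integral_mono_arc[OF a Q])
      fix c assume "c \<in> {lower N (i, j)..upper N (i, j)}"
      then have "exp (- (s + c)) \<le> exp (- s) * exp (- d)" using d(2)[OF a] by (simp flip: exp_add)
      then have "\<kappa> * exp (- (s + c)) \<le> \<kappa> * (exp (- s) * exp (- d))" using assms by (intro mult_left_mono) auto
      then show "?k c \<le> max 0 (?g c)" by (simp add: mult.assoc)
    qed (rule cont(2) cont_max)+
    finally have "ennreal (arc_loss (i, j) (node_loss j) s - \<kappa> * exp (- s)) \<le> ennreal (\<integral>c. max 0 (?g c) \<partial>Q)"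
      by (rule ennreal_leI)
    also have "\<dots> = (\<integral>\<^sup>+c. ennreal (max 0 (?g c)) \<partial>Q)"
      by (rule nn_integral_eq_integral[symmetric, OF integrable_continuous[OF a Q cont_max]]) simp
    also have "\<dots> = (\<integral>\<^sup>+c. ennreal (?g c) \<partial>Q)"
      by (intro nn_integral_cong) (auto simp: max_def ennreal_neg)
    finally show "ennreal (arc_loss (i, j) (node_loss j) (\<tau> - T) - \<kappa> * exp (- (\<tau> - T))) \<le>
      (\<integral>\<^sup>+c. ennreal (node_loss j (\<tau> + c - T) - \<kappa> * exp (- (\<tau> + c - T))) \<partial>q (i, j) (\<tau> - T))"
      by (simp add: s_def Q_def algebra_simps)
  qed
qed

text \<open>The family is fixed before the strategy and works against all of them. The hypothesis on
  arcs is restricted to excess at least \<open>S\<close>, which suffices because later histories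
  have spent at least as much as \<open>h\<close>.\<close>

lemma near_worst_loss_ge:
  assumes h: "h \<in> histories N" "current N h \<noteq> dest N" and "\<kappa> > 0"
    and K: "\<And>s i. s \<ge> S \<Longrightarrow> node_loss i s \<le> K * l s" and S: "S \<le> spent h - T" and "K > 0"
    and arc: "\<And>s i j. s \<ge> S \<Longrightarrow> (i, j) \<in> parcs (graph N) \<Longrightarrow> i \<noteq> dest N \<Longrightarrow>
      node_loss i s \<le> arc_loss (i, j) (node_loss j) s"
  obtains p where "p \<in> cost_families N"
    "\<And>\<pi>. \<pi> \<in> strategies N \<Longrightarrow> (\<Sum>j\<in>successors N (current N h). ennreal (pmf (\<pi> h) j) *
        ennreal (arc_loss (current N h, j) (node_loss j) (spent h - T) - \<kappa> * exp (- (spent h - T)))) \<le>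
      (\<integral>\<^sup>+\<omega>. final_loss T (total_cost h \<omega>) \<partial>trajectory N p \<pi> h)"
proof (rule near_worst_family[OF \<open>\<kappa> > 0\<close>, of T])
  fix p assume p: "p \<in> cost_families N"
    "\<And>\<tau> i j. \<tau> \<ge> 0 \<Longrightarrow> (i, j) \<in> parcs (graph N) \<Longrightarrow>
      ennreal (arc_loss (i, j) (node_loss j) (\<tau> - T) - \<kappa> * exp (- (\<tau> - T))) \<le>
      (\<integral>\<^sup>+c. ennreal (node_loss j (\<tau> + c - T) - \<kappa> * exp (- (\<tau> + c - T))) \<partial>p \<tau> (i, j))"
  show thesis
  proof (rule that[OF p(1)])
    fix \<pi> assume \<pi>: "\<pi> \<in> strategies N"
    interpret routing_run N p \<pi> h by unfold_locales (fact p(1) \<pi> h(1))+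
    let ?\<psi> = "\<lambda>i r. ennreal (node_loss i (r - T) - \<kappa> * exp (- (r - T)))"
    have \<psi>: "?\<psi> i \<in> borel_measurable borel" "i \<notin> pverts (graph N) \<Longrightarrow> ?\<psi> i = ?\<psi> (dest N)" for i
      by (auto simp: node_loss_outside)
    have next_ge: "(\<Sum>j\<in>successors N (current N h'). ennreal (pmf (\<pi> h') j) *
        ennreal (arc_loss (current N h', j) (node_loss j) (spent h' - T) - \<kappa> * exp (- (spent h' - T))))
      \<le> next_stage ?\<psi> h'" if h': "h' \<in> histories N" "current N h' \<noteq> dest N" for h'
      by (rule ord_le_eq_trans[OF _ next_stage_sum[of ?\<psi>, OF \<psi> h', symmetric]])
        (intro sum_mono mult_left_mono p(2) spent_nonneg[OF h'(1)], auto)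
    have step: "?\<psi> (current N h') (spent h') \<le> next_stage ?\<psi> h'"
      if h': "h' \<in> histories N" "current N h' \<noteq> dest N" "spent h \<le> spent h'" for h'
    proof -
      \<comment> \<open>The weights sum to 1, so the node value can be compared with the weighted
        arc values term by term.\<close>
      have "?\<psi> (current N h') (spent h') =
          (\<Sum>j\<in>successors N (current N h'). ennreal (pmf (\<pi> h') j) * ?\<psi> (current N h') (spent h'))"
        unfolding sum_distrib_right[symmetric]
        by (subst sum_ennreal)
          (auto simp: sum_pmf_eq_1[OF finite_successors \<pi>_successors[OF h'(1,2)]])
      also have "\<dots> \<le> (\<Sum>j\<in>successors N (current N h'). ennreal (pmf (\<pi> h') j) *
        ennreal (arc_loss (current N h', j) (node_loss j) (spent h' - T) - \<kappa> * exp (- (spent h' - T))))"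
        using S h' by (intro sum_mono mult_left_mono ennreal_leI diff_right_mono arc) auto
      also have "\<dots> \<le> next_stage ?\<psi> h'" by (rule next_ge[OF h'(1,2)])
      finally show ?thesis .
    qed
    show "(\<Sum>j\<in>successors N (current N h). ennreal (pmf (\<pi> h) j) *
        ennreal (arc_loss (current N h, j) (node_loss j) (spent h - T) - \<kappa> * exp (- (spent h - T)))) \<le>
      (\<integral>\<^sup>+\<omega>. final_loss T (total_cost h \<omega>) \<partial>traj)"
    proof (rule order_trans[OF next_ge[OF h]], rule nn_integral_final_loss_ge[OF routing_run_axioms _ K S \<open>K > 0\<close>])
      fix n
      have "next_stage ?\<psi> h \<le> (\<integral>\<^sup>+\<omega>. stage ?\<psi> (Suc n) \<omega> \<partial>traj)"
        by (rule nn_integral_stage_ge[of ?\<psi>, OF \<psi> step])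
      \<comment> \<open>Once the stages are summed up, dropping the slack only increases the
        right-hand side.\<close>
      also have "\<dots> \<le> (\<integral>\<^sup>+\<omega>. stage_loss T (h @ map \<omega> [0..<Suc n]) \<partial>traj)"
        using \<open>\<kappa> > 0\<close> by (intro nn_integral_mono ennreal_leI) (simp add: less_imp_le)
      finally show "next_stage ?\<psi> h \<le> (\<integral>\<^sup>+\<omega>. stage_loss T (h @ map \<omega> [0..<Suc n]) \<partial>traj)" .
    qed
  qed
qed

text \<open>As \<open>l\<close> is positive, all payoffs from \<open>h\<close> on are negative, so
  the expectation is minus a single nonnegative integral and no difference of infinities arises. The
  value of a trajectory that never arrives is the limit of \<open>f\<close>, here minus infinity, in
  agreement with \<open>final_loss\<close>.\<close>

lemma expected_payoff_eq:
  assumes f: "\<And>s. s \<ge> s0 \<Longrightarrow> l s = - f (- s)" and h: "h \<in> histories N" "s0 \<le> spent h - T"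
  shows "expected_payoff N f T p \<pi> h = - enn2ereal (\<integral>\<^sup>+\<omega>. final_loss T (total_cost h \<omega>) \<partial>trajectory N p \<pi> h)"
proof -
  have "((\<lambda>t. ereal (f t)) \<longlongrightarrow> - \<infinity>) at_bot"
  proof -
    have "filterlim (\<lambda>t. - l (- t)) at_bot at_bot"
      by (intro filterlim_compose[OF filterlim_uminus_at_bot_at_top] filterlim_compose[OF loss_at_top filterlim_uminus_at_top_at_bot])
    moreover have "\<forall>\<^sub>F t in at_bot. - l (- t) = f t"
      using eventually_le_at_bot[of "- s0"] by eventually_elim (use f[of "- t" for t] in auto)
    ultimately have "filterlim f at_bot at_bot" by (simp cong: filterlim_cong)
    then show ?thesis by (simp add: tendsto_MInfty filterlim_at_bot_dense)
  qed
  then have Lim: "Lim at_bot (\<lambda>t. ereal (f t)) = - \<infinity>" by (intro tendsto_Lim) auto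
  have payoff: "e2ennreal (payoff f T (total_cost h \<omega>)) = 0"
    "e2ennreal (- payoff f T (total_cost h \<omega>)) = final_loss T (total_cost h \<omega>)" for \<omega>
  proof -
    have *: "payoff f T (total_cost h \<omega>) = (if total_cost h \<omega> = \<infinity> then - \<infinity>
        else ereal (- l (enn2real (total_cost h \<omega>) - T)))"
    proof (cases "total_cost h \<omega>")
      case (real r)
      have "spent h \<le> r" using total_cost_ge[of h \<omega>] real by simp
      then have "l (r - T) = - f (- (r - T))" using h by (intro f) auto
      with real show ?thesis by (simp add: payoff_def)
    qed (simp add: payoff_def Lim)
    show "e2ennreal (payoff f T (total_cost h \<omega>)) = 0"
      unfolding * using loss_ge_1[of "enn2real (total_cost h \<omega>) - T"] by (auto simp: ennreal_neg e2ennreal_neg)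
    show "e2ennreal (- payoff f T (total_cost h \<omega>)) = final_loss T (total_cost h \<omega>)"
      unfolding * final_loss_def by simp
  qed
  show ?thesis unfolding expected_payoff_def ereal_expectation_def payoff by (simp add: zero_ennreal.rep_eq)
qed

text \<open>The threshold is found before \<open>T\<close>, \<open>h\<close> and the strategy. The
  two martingale bounds squeeze the average of the arc values \<open>W j\<close> to at most the node
  loss, while each \<open>W j\<close> is at least the node loss. Hence every arc with positive
  weight attains it, which arcs off the tree fail to do.\<close>

lemma optimal_follows_tree:
  assumes f: "\<And>s. s \<ge> s0 \<Longrightarrow> l s = - f (- s)"
  shows "\<exists>S. \<forall>T. \<forall>h\<in>histories N. current N h \<noteq> dest N \<and> S < spent h - T \<longrightarrow>
    (\<forall>\<pi>. optimal_from N f T \<pi> h \<longrightarrow> set_pmf (\<pi> h) \<subseteq> tree_successors N (current N h))"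
proof -
  obtain K where "\<forall>\<^sub>F s in at_top. \<forall>i. node_loss i s \<le> K * l s" using eventually_node_loss_le by blast
  \<comment> \<open>Nonnegative excess makes \<open>exp (- s)\<close> at most 1; excess at least
    \<open>s0\<close> makes \<open>l\<close> represent \<open>f\<close>.\<close>
  with eventually_off_tree eventually_ge_at_top[of "max 0 s0"]
  have "\<forall>\<^sub>F s in at_top. (\<forall>(i, j)\<in>parcs (graph N). i \<noteq> dest N \<longrightarrow> j \<notin> tree_successors N i \<longrightarrow>
     node_loss i s < arc_loss (i, j) (node_loss j) s) \<and> s \<ge> max 0 s0 \<and> (\<forall>i. node_loss i s \<le> K * l s)"
    by eventually_elim blast
  then obtain S where S: "\<And>s i j. s \<ge> S \<Longrightarrow> (i, j) \<in> parcs (graph N) \<Longrightarrow> i \<noteq> dest N \<Longrightarrow>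
      j \<notin> tree_successors N i \<Longrightarrow> node_loss i s < arc_loss (i, j) (node_loss j) s"
    "S \<ge> 0" "S \<ge> s0" "\<And>s i. s \<ge> S \<Longrightarrow> node_loss i s \<le> K * l s"
    unfolding eventually_at_top_linorder by fastforce
  have "K > 0"
    using S(4)[OF order_refl, of "dest N"] node_loss_ge_1[of "dest N" S] loss_ge_1[of S]
    by (smt (verit) mult_nonpos_nonneg)
  have arc: "node_loss i s \<le> arc_loss (i, j) (node_loss j) s"
    if "s \<ge> S" "(i, j) \<in> parcs (graph N)" "i \<noteq> dest N" for s i j
    using S(1)[OF that] node_loss_tree_le[OF _ that(3), of j s] arc_verts[OF that(2)]
    by (cases "j \<in> tree_successors N i") auto
  show ?thesis
  proof (intro exI[of _ S] allI ballI impI, elim conjE)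
    fix T h \<pi> assume h: "h \<in> histories N" "current N h \<noteq> dest N" and "S < spent h - T" and opt: "optimal_from N f T \<pi> h"
    define i s where "i = current N h" and "s = spent h - T"
    have s: "S \<le> s" "0 \<le> s" "s0 \<le> s" using \<open>S < spent h - T\<close> S by (auto simp: s_def)
    have payoff: "expected_payoff N f T p \<pi>' h =
        - enn2ereal (\<integral>\<^sup>+\<omega>. final_loss T (total_cost h \<omega>) \<partial>trajectory N p \<pi>' h)" for p \<pi>'
      by (rule expected_payoff_eq[OF _ h(1) s(3)[unfolded s_def]]) (rule f)
    define W where "W j = arc_loss (i, j) (node_loss j) s" for j
    have \<pi>: "\<pi> \<in> strategies N" using opt by (simp add: optimal_from_def)
    have succ: "set_pmf (\<pi> h) \<subseteq> successors N i" using \<pi> h by (auto simp: strategies_def i_def)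
    have sum1: "(\<Sum>j\<in>successors N i. pmf (\<pi> h) j) = 1" by (rule sum_pmf_eq_1[OF finite_successors succ])
    have W_ge: "node_loss i s \<le> W j" if "j \<in> successors N i" for j
      using arc[OF s(1), of i j] that h(2) by (simp add: W_def i_def)
    have "- enn2ereal (ennreal (node_loss i s)) \<le> worst_case_payoff N f T (best_strategy T) h"
      unfolding worst_case_payoff_def payoff
      using best_strategy_loss_le[OF _ h(1)] by (intro INF_greatest) (simp add: i_def s_def less_eq_ennreal.rep_eq)
    also have "\<dots> \<le> worst_case_payoff N f T \<pi> h"
      using opt best_strategy by (auto simp: optimal_from_def intro: SUP_upper)
    finally have lower: "- enn2ereal (ennreal (node_loss i s)) \<le> worst_case_payoff N f T \<pi> h" .
    have "(\<Sum>j\<in>successors N i. pmf (\<pi> h) j * W j) \<le> node_loss i s + \<epsilon>" if "\<epsilon> > 0" for \<epsilon>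
    proof -
      \<comment> \<open>The bound 1 keeps the reduced arc values nonnegative, since node losses are
        at least 1, so the extended sum is an ordinary one. The bound \<open>\<epsilon>\<close>
        controls the slack in the final estimate.\<close>
      define \<kappa> where "\<kappa> = min 1 \<epsilon>"
      have \<kappa>: "\<kappa> > 0" "\<kappa> \<le> 1" "\<kappa> \<le> \<epsilon>" using that by (auto simp: \<kappa>_def)
      have "\<kappa> * exp (- s) \<le> \<kappa>" using mult_left_mono[of "exp (- s)" 1 \<kappa>] s \<kappa> by simp
      note small = order_trans[OF this \<kappa>(2)] order_trans[OF this \<kappa>(3)]
      obtain p where p: "p \<in> cost_families N"
        "(\<Sum>j\<in>successors N i. ennreal (pmf (\<pi> h) j) * ennreal (W j - \<kappa> * exp (- s))) \<le>
          (\<integral>\<^sup>+\<omega>. final_loss T (total_cost h \<omega>) \<partial>trajectory N p \<pi> h)"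
      proof (rule near_worst_loss_ge[OF h \<kappa>(1) S(4) s(1)[unfolded s_def] \<open>K > 0\<close> arc])
        fix p assume "p \<in> cost_families N" and ge: "\<And>\<pi>. \<pi> \<in> strategies N \<Longrightarrow>
          (\<Sum>j\<in>successors N (current N h). ennreal (pmf (\<pi> h) j) * ennreal
            (arc_loss (current N h, j) (node_loss j) (spent h - T) - \<kappa> * exp (- (spent h - T)))) \<le>
          (\<integral>\<^sup>+\<omega>. final_loss T (total_cost h \<omega>) \<partial>trajectory N p \<pi> h)"
        then show thesis using ge[OF \<pi>] that[of p] by (simp add: W_def i_def s_def)
      qed
      have "worst_case_payoff N f T \<pi> h \<le> expected_payoff N f T p \<pi> h"
        unfolding worst_case_payoff_def by (rule INF_lower[OF p(1)])
      from order_trans[OF lower this]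
      have "(\<integral>\<^sup>+\<omega>. final_loss T (total_cost h \<omega>) \<partial>trajectory N p \<pi> h) \<le> ennreal (node_loss i s)"
        unfolding payoff by (simp only: ereal_minus_le_minus less_eq_ennreal.rep_eq)
      with p(2) have "(\<Sum>j\<in>successors N i. ennreal (pmf (\<pi> h) j) * ennreal (W j - \<kappa> * exp (- s))) \<le> ennreal (node_loss i s)"
        by (rule order_trans)
      also have "(\<Sum>j\<in>successors N i. ennreal (pmf (\<pi> h) j) * ennreal (W j - \<kappa> * exp (- s))) =
          ennreal (\<Sum>j\<in>successors N i. pmf (\<pi> h) j * (W j - \<kappa> * exp (- s)))"
      proof -
        have "0 \<le> W j - \<kappa> * exp (- s)" if "j \<in> successors N i" for j
          using W_ge[OF that] node_loss_ge_1[of i s] small by linarith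
        then show ?thesis by (subst sum_ennreal[symmetric]) (auto simp: ennreal_mult intro!: sum.cong)
      qed
      finally have "(\<Sum>j\<in>successors N i. pmf (\<pi> h) j * (W j - \<kappa> * exp (- s))) \<le> node_loss i s"
        using node_loss_ge_1[of i s] by (subst (asm) ennreal_le_iff) auto
      also have "(\<Sum>j\<in>successors N i. pmf (\<pi> h) j * (W j - \<kappa> * exp (- s))) =
          (\<Sum>j\<in>successors N i. pmf (\<pi> h) j * W j) - \<kappa> * exp (- s)"
        by (simp add: right_diff_distrib sum_subtractf sum1 flip: sum_distrib_right)
      finally show ?thesis using small by linarith
    qed
    \<comment> \<open>The cost family varied with \<open>\<epsilon>\<close>, but neither side of
      this inequality mentions it.\<close>
    then have "(\<Sum>j\<in>successors N i. pmf (\<pi> h) j * W j) \<le> node_loss i s" by (rule field_le_epsilon)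
    moreover have "(\<Sum>j\<in>successors N i. pmf (\<pi> h) j * (W j - node_loss i s)) =
        (\<Sum>j\<in>successors N i. pmf (\<pi> h) j * W j) - node_loss i s"
      by (simp add: right_diff_distrib sum_subtractf sum1 flip: sum_distrib_right)
    moreover have nonneg: "0 \<le> pmf (\<pi> h) j * (W j - node_loss i s)" if "j \<in> successors N i" for j
      using W_ge[OF that] by simp
    ultimately have zero: "(\<Sum>j\<in>successors N i. pmf (\<pi> h) j * (W j - node_loss i s)) = 0"
      using sum_nonneg[of "successors N i" "\<lambda>j. pmf (\<pi> h) j * (W j - node_loss i s)"] by force
    show "set_pmf (\<pi> h) \<subseteq> tree_successors N (current N h)"
    proof (rule subsetI, rule ccontr)
      fix j assume j: "j \<in> set_pmf (\<pi> h)" "j \<notin> tree_successors N (current N h)"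
      then have "j \<in> successors N i" using succ by auto
      have "node_loss i s < W j"
        using S(1)[OF s(1), of i j] \<open>j \<in> successors N i\<close> h(2) j(2) by (simp add: W_def i_def)
      moreover have "pmf (\<pi> h) j * (W j - node_loss i s) = 0"
        using zero \<open>j \<in> successors N i\<close> nonneg
        by (subst (asm) sum_nonneg_eq_0_iff[OF finite_successors]) auto
      ultimately show False using j(1) by (simp add: set_pmf_iff)
    qed
  qed
qed

end

text \<open>The total cost is at least \<open>spent h\<close>, so \<open>f\<close> is evaluated to
  the left of its support, and trajectories that never arrive get the limit 0. In Case 2 all
  strategies therefore have the same value.\<close>

lemma payoff_eq_0:
  fixes f :: "real \<Rightarrow> real"
  assumes supp: "closure {t. f t \<noteq> 0} \<subseteq> {T\<^sub>f..}" and "0 \<le> spent h" "spent h > T - T\<^sub>f"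
  shows "payoff f T (total_cost h \<omega>) = 0"
proof -
  have f: "f t = 0" if "t < T\<^sub>f" for t
    using that supp closure_subset[of "{t. f t \<noteq> 0}"] by force
  show ?thesis
  proof (cases "total_cost h \<omega>")
    case (real r)
    have "ennreal (spent h) \<le> total_cost h \<omega>" by (simp add: total_cost_def)
    with real have "spent h \<le> r" by simp
    with real f[of "T - r"] assms(3) show ?thesis by (simp add: payoff_def)
  next
    case top
    have "((\<lambda>t. ereal (f t)) \<longlongrightarrow> 0) at_bot"
    proof (rule tendsto_eventually)
      show "\<forall>\<^sub>F t in at_bot. ereal (f t) = 0"
        using eventually_gt_at_bot[of "T\<^sub>f"] by eventually_elim (simp add: f)
    qed
    then have "Lim at_bot (\<lambda>t. ereal (f t)) = 0" by (intro tendsto_Lim) auto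
    with top show ?thesis by (simp add: payoff_def)
  qed
qed

theorem theorem2:
  fixes N :: "'v network" and f :: "real \<Rightarrow> real"
  assumes "robust_routing N"
  shows
    "((\<exists>T\<^sub>1.
         strict_mono_on {..<T\<^sub>1} f \<and> concave_on {..<T\<^sub>1} f \<and>
         f C1_differentiable_on {..<T\<^sub>1} \<and> deriv f C1_differentiable_on {..<T\<^sub>1} \<and>
         ((\<lambda>t. deriv (deriv f) t / deriv f t) \<longlongrightarrow> 0) at_bot
       \<or> f C1_differentiable_on {..<T\<^sub>1} \<and> (\<exists>L>0. (deriv f \<longlongrightarrow> L) at_bot))
      \<longrightarrow>
      (\<exists>T\<^sub>r. \<forall>T\<ge>0. \<forall>h\<in>histories N. current N h \<noteq> dest N \<and> spent h > T - T\<^sub>r \<longrightarrow>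
         (\<forall>\<pi>. optimal_from N f T \<pi> h \<longrightarrow> set_pmf (\<pi> h) \<subseteq> tree_successors N (current N h))))
     \<and>
     (\<forall>T\<^sub>f. closure {t. f t \<noteq> 0} \<subseteq> {T\<^sub>f..} \<longrightarrow>
       (\<forall>T\<ge>0. \<forall>h\<in>histories N. current N h \<noteq> dest N \<and> spent h > T - T\<^sub>f \<longrightarrow>
         (\<forall>\<pi>\<in>strategies N. follows_tree_from N \<pi> h \<longrightarrow> optimal_from N f T \<pi> h)))"
proof (intro conjI impI allI ballI; (elim exE conjE)?)
  interpret robust_routing N by fact
  fix T\<^sub>1 assume "strict_mono_on {..<T\<^sub>1} f \<and> concave_on {..<T\<^sub>1} f \<and>
         f C1_differentiable_on {..<T\<^sub>1} \<and> deriv f C1_differentiable_on {..<T\<^sub>1} \<and>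
         ((\<lambda>t. deriv (deriv f) t / deriv f t) \<longlongrightarrow> 0) at_bot
       \<or> f C1_differentiable_on {..<T\<^sub>1} \<and> (\<exists>L>0. (deriv f \<longlongrightarrow> L) at_bot)"
  from loss_of_risk_function[OF this] obtain l F s0 where l: "continuous_on UNIV l" "mono l" "\<And>s. 1 \<le> l s"
    "filterlim l at_top at_top" "\<forall>\<^sub>F s in at_top. F s > 0" "first_order l F l 0"
    "\<And>s. s \<ge> s0 \<Longrightarrow> l s = - f (- s)" by metis
  interpret tail_loss N l F by unfold_locales (fact l)+
  obtain S where S: "\<And>T h \<pi>. h \<in> histories N \<Longrightarrow> current N h \<noteq> dest N \<Longrightarrow> S < spent h - T \<Longrightarrow>
      optimal_from N f T \<pi> h \<Longrightarrow> set_pmf (\<pi> h) \<subseteq> tree_successors N (current N h)"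
    using optimal_follows_tree[OF l(7)] by blast
  show "\<exists>T\<^sub>r. \<forall>T\<ge>0. \<forall>h\<in>histories N. current N h \<noteq> dest N \<and> spent h > T - T\<^sub>r \<longrightarrow>
         (\<forall>\<pi>. optimal_from N f T \<pi> h \<longrightarrow> set_pmf (\<pi> h) \<subseteq> tree_successors N (current N h))"
  proof (intro exI[of _ "- S"] allI ballI impI)
    fix T h \<pi> assume "h \<in> histories N" "current N h \<noteq> dest N \<and> spent h > T - - S" "optimal_from N f T \<pi> h"
    then show "set_pmf (\<pi> h) \<subseteq> tree_successors N (current N h)" by (intro S) auto
  qed
next
  interpret robust_routing N by fact
  fix T\<^sub>f T h \<pi> assume A: "closure {t. f t \<noteq> 0} \<subseteq> {T\<^sub>f..}" "h \<in> histories N" "spent h > T - T\<^sub>f"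
    and \<pi>: "\<pi> \<in> strategies N"
  have "expected_payoff N f T p \<pi>' h = 0" for p \<pi>'
    unfolding expected_payoff_def ereal_expectation_def payoff_eq_0[OF A(1) spent_nonneg[OF A(2)] A(3)]
    by (simp add: e2ennreal_neg)
  then have "worst_case_payoff N f T \<pi>' h = worst_case_payoff N f T \<pi> h" for \<pi>'
    by (simp add: worst_case_payoff_def)
  with \<pi> show "optimal_from N f T \<pi> h"
    unfolding optimal_from_def by (metis SUP_eq_const empty_iff)
qed

end
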